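(* Suppose $\partial\Omega$ is $C^2$ and there exists $\epsilon>0$ such that we know $g(s,r)$ for all $(s,r)\in[0,L)\times(0,\epsilon)$. This information is enough to determine the curvature of every point on $\partial\Omega$. In particular, if $\gamma:[0,L)\to\partial\Omega$ is a counterclockwise arclength parameterization of $\partial\Omega$, then for every $s$ $$\kappa(\gamma(s))=-3\pi\lim_{r\to0}\frac{\partial}{\partial r}\,\frac{g(s,r)}{\pi r^2}.$$
   Context: $\Omega\subset\mathbb R^2$ is a compact set whose boundary $\partial\Omega$ is a simple closed curve of length $L$; $D(p,r)$ is the closed disk of radius $r$ about $p$; $g(s,r)=\operatorname{Area}(\Omega\cap D(\gamma(s),r))$. $\kappa$ is the signed curvature of $\partial\Omega$ with respect to the counterclockwise traversal (positive for a disk).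
   Formalization: The set Ω is additionally assumed to have nonempty interior, which excludes only the case where Ω is the boundary curve itself; there g is identically 0 and the curvature formula fails (for example, for a circle). *)

theory Defs
  imports "HOL-Complex_Analysis.Complex_Analysis"
begin

text \<open>
  The Euclidean plane is modelled by the type of complex numbers. A parameterization
  of a closed curve on a half-open interval \<open>[0,T)\<close> is represented by its \<open>T\<close>-periodic
  extension to the real line, so that differentiability also covers the closing point.
\<close>

definition simple_closed_param :: "complex set \<Rightarrow> real \<Rightarrow> (real \<Rightarrow> complex) \<Rightarrow> bool" where
  "simple_closed_param C T c \<longleftrightarrow>
     0 < T \<and> continuous_on UNIV c \<and> (\<forall>t. c (t + T) = c t) \<and>
     inj_on c {0..<T} \<and> c ` {0..<T} = C"

definition C2_regular_param :: "complex set \<Rightarrow> real \<Rightarrow> (real \<Rightarrow> complex) \<Rightarrow> bool" where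
  "C2_regular_param C T c \<longleftrightarrow>
     simple_closed_param C T c \<and>
     c C1_differentiable_on UNIV \<and>
     (\<lambda>t. vector_derivative c (at t)) C1_differentiable_on UNIV \<and>
     (\<forall>t. vector_derivative c (at t) \<noteq> 0)"

definition C2_simple_closed_curve :: "complex set \<Rightarrow> bool" where
  "C2_simple_closed_curve C \<longleftrightarrow> (\<exists>T c. C2_regular_param C T c)"

text \<open>A curve with an arclength parameterization of period \<open>L\<close> has length \<open>L\<close>.\<close>

definition arclength_param :: "complex set \<Rightarrow> real \<Rightarrow> (real \<Rightarrow> complex) \<Rightarrow> bool" where
  "arclength_param C L \<gamma> \<longleftrightarrow>
     simple_closed_param C L \<gamma> \<and>
     (\<forall>s. \<gamma> differentiable (at s) \<and> norm (vector_derivative \<gamma> (at s)) = 1)"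

text \<open>Library paths live on \<open>[0,1]\<close>, hence the rescaling by \<open>T\<close>.\<close>

definition counterclockwise :: "complex set \<Rightarrow> real \<Rightarrow> (real \<Rightarrow> complex) \<Rightarrow> bool" where
  "counterclockwise C T c \<longleftrightarrow> (\<forall>z\<in>inside C. winding_number (\<lambda>t. c (T * t)) z = 1)"

text \<open>
  \<open>det (c', c'') / |c'|\<^sup>3\<close>, the determinant being written as \<open>Im (cnj c' * c'')\<close>.
\<close>

definition signed_curvature :: "(real \<Rightarrow> complex) \<Rightarrow> real \<Rightarrow> real" where
  "signed_curvature c t =
     (let v = (\<lambda>u. vector_derivative c (at u))
      in Im (cnj (v t) * vector_derivative v (at t)) / norm (v t) ^ 3)"

text \<open>
  The curvature as a function on the points of the curve. It is independent of the
  counterclockwise parameterization, hence the definite description.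
\<close>

definition curvature_at :: "complex set \<Rightarrow> complex \<Rightarrow> real" where
  "curvature_at C p =
     (THE k. \<exists>T c t. C2_regular_param C T c \<and> counterclockwise C T c \<and>
                     c t = p \<and> k = signed_curvature c t)"

text \<open>
  The condition on the interior rules out the degenerate compact set that consists of
  the curve alone, which is its own topological boundary.
\<close>

definition C2_region :: "complex set \<Rightarrow> bool" where
  "C2_region \<Omega> \<longleftrightarrow> compact \<Omega> \<and> interior \<Omega> \<noteq> {} \<and> C2_simple_closed_curve (frontier \<Omega>)"

definition disk_area :: "complex set \<Rightarrow> (real \<Rightarrow> complex) \<Rightarrow> real \<Rightarrow> real \<Rightarrow> real" where
  "disk_area \<Omega> \<gamma> s r = measure lebesgue (\<Omega> \<inter> cball (\<gamma> s) r)"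

end

theory Submission
  imports Defs
begin

text \<open>
  Write \<open>A r\<close> for the area of \<open>\<Omega> \<inter> D(p,r)\<close>. For small \<open>\<rho>\<close> the boundary meets the circle of radius \<open>\<rho>\<close>
  about \<open>p\<close> in exactly two points, one on each branch, so \<open>\<Omega>\<close> meets that circle in an arc, of
  angle \<open>\<theta> \<rho>\<close> say. Hence \<open>A' r = r * \<theta> r\<close>, and a second-order expansion of the two branches gives
  \<open>\<theta> r = \<pi> - \<kappa> r + o(r)\<close>. L'Hospital's rule then yields the limit of the derivative of
  \<open>A r / (\<pi> r\<^sup>2)\<close>. That the arc lies to the left of a counterclockwise curve follows from comparing the
  winding numbers about \<open>p + \<i>\<epsilon>v\<close> and \<open>p - \<i>\<epsilon>v\<close>, where \<open>v\<close> is the unit tangent: their difference is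
  an integral with positive real part for small \<open>\<epsilon>\<close>, while both numbers are \<open>0\<close> or \<open>1\<close>. Since the
  limit involves \<open>p\<close> and \<open>\<Omega>\<close> only, it also shows that the curvature does not depend on the
  parameterization.
\<close>

text \<open>An expansion A r = pi r^2 / 2 - kappa r^3 / 3 + o(r^3) alone would not give the limit of
  a derivative, because the remainder may oscillate. The exact identity for \<open>A'\<close>
  removes this obstacle: the derivative of the density becomes an expression in \<theta> r and A r
  without derivatives, and for these asymptotics are enough. The 3 in the constant comes from
  integrating kappa r^2. Two facts used near p are not local. The curve might come back close to p
  at a later time; injectivity and compactness over one period give a positive distance \<eta>
  between p and the rest of the curve, and only circles of radius below \<eta> are considered. Also,
  the germ of the curve does not tell which of its sides is filled by the region; that is global
  information, and it enters through an integral over a whole period.\<close>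

section \<open>Area in polar coordinates\<close>

text \<open>Bridge between \<open>complex\<close> and \<open>real^2\<close>, where the invariance of
  measure under orthogonal maps is available as \<open>measure_orthogonal_image\<close>. Agreement
  on boxes suffices.\<close>

lemma lborel_complex_vec:
  "distr lborel borel (\<lambda>v::real^2. Complex (v $ 1) (v $ 2)) = lborel"
proof (rule lborel_eqI[symmetric])
  fix l u :: complex assume le: "\<And>b. b \<in> Basis \<Longrightarrow> l \<bullet> b \<le> u \<bullet> b"
  let ?f = "\<lambda>v::real^2. Complex (v $ 1) (v $ 2)"
  have [measurable]: "?f \<in> borel_measurable borel"
    by (intro borel_measurable_continuous_onI) (auto simp: Complex_eq intro!: continuous_intros)
  have eq: "?f -` box l u = box (vector [Re l, Im l]) (vector [Re u, Im u])"
    by (auto simp: mem_box_cart in_box_complex_iff forall_2)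
  have lr: "Re l \<le> Re u" "Im l \<le> Im u" using le[of 1] le[of \<i>] by (auto simp: Basis_complex_def)
  show "emeasure (distr lborel borel ?f) (box l u) = (\<Prod>b\<in>Basis. (u - l) \<bullet> b)"
    using lr by (simp add: emeasure_distr eq emeasure_lborel_box_eq Basis_vec_def Basis_complex_def
       inner_axis UNIV_2 axis_eq_axis algebra_simps)
qed simp

lemma lborel_distr_rotation:
  fixes u :: complex
  assumes u: "norm u = 1"
  shows "distr lborel borel (\<lambda>z. u * z) = lborel"
proof (rule lborel_eqI[symmetric])
  fix l r :: complex assume le: "\<And>b. b \<in> Basis \<Longrightarrow> l \<bullet> b \<le> r \<bullet> b"
  let ?f = "\<lambda>v::real^2. Complex (v $ 1) (v $ 2)"
  let ?g = "\<lambda>z. vector [Re z, Im z] :: real^2"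
  let ?R = "\<lambda>v. ?g (cnj u * ?f v)"
  have fg: "?f (?g z) = z" for z by (simp add: complex_eq_iff)
  have gf: "?g (?f v) = v" for v by (simp add: vec_eq_iff forall_2)
  have uu: "u * cnj u = 1" using u by (simp add: complex_mult_cnj cmod_def)
  have [measurable]: "?f \<in> borel_measurable borel"
    by (intro borel_measurable_continuous_onI) (auto simp: Complex_eq intro!: continuous_intros)
  have R: "orthogonal_transformation ?R"
  proof -
    have lin: "linear ?R"
      by (rule linearI) (auto simp: vec_eq_iff forall_2 algebra_simps)
    have "norm (?R v) = norm v" for v
    proof -
      have n: "norm (?g z) = cmod z" for z
        by (simp add: norm_vec_def L2_set_def sum_2 cmod_def)
      have "norm v = cmod (?f v)"
        using n[of "?f v"] by (simp only: gf)
      then show ?thesis by (simp only: n norm_mult complex_mod_cnj u mult_1)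
    qed
    with lin show ?thesis by (simp add: orthogonal_transformation)
  qed
  have m: "emeasure lborel S = emeasure lborel (?f -` S)" if "S \<in> sets borel" for S
    using that by (subst lborel_complex_vec[symmetric]) (simp add: emeasure_distr)
  have B: "(*) u -` box l r \<in> sets borel"
    by (rule measurable_sets_borel[of _ borel]) (auto intro!: borel_measurable_continuous_onI continuous_intros)
  \<comment> \<open>\<open>measure_orthogonal_image\<close> speaks of images, the pushforward of
    preimages; the preimage under multiplication by \<open>u\<close> is the image under
    multiplication by \<open>cnj u\<close>.\<close>
  have img: "?f -` ((*) u -` box l r) = ?R ` (?f -` box l r)"
  proof (intro equalityI subsetI)
    fix v assume v: "v \<in> ?f -` ((*) u -` box l r)"
    have "v = ?R (?g (u * ?f v))"
      using uu by (simp only: fg gf mult.assoc[symmetric] mult.commute[of "cnj u"] mult_1)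
    moreover have "?g (u * ?f v) \<in> ?f -` box l r" using v by (simp only: fg vimage_eq)
    ultimately show "v \<in> ?R ` (?f -` box l r)" by (rule image_eqI)
  next
    fix v assume "v \<in> ?R ` (?f -` box l r)"
    then obtain w where w: "v = ?R w" "?f w \<in> box l r" by auto
    have "u * ?f v = ?f w" unfolding w(1) fg by (simp only: mult.assoc[symmetric] uu mult_1)
    then show "v \<in> ?f -` ((*) u -` box l r)" using w(2) by (simp only: vimage_eq)
  qed
  have "emeasure (distr lborel borel (\<lambda>z. u * z)) (box l r) = emeasure lborel ((*) u -` box l r)"
    by (subst emeasure_distr) auto
  also have "\<dots> = emeasure lborel (?f -` ((*) u -` box l r))"
    using B by (rule m)
  also have "\<dots> = emeasure lborel (?R ` (?f -` box l r))" by (simp only: img)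
  also have "\<dots> = emeasure lborel (?f -` box l r)"
  proof -
    have eq: "?f -` box l r = box (vector [Re l, Im l]) (vector [Re r, Im r])"
      by (auto simp: mem_box_cart in_box_complex_iff forall_2)
    have S: "?f -` box l r \<in> lmeasurable" unfolding eq by simp
    have RS: "?R ` (?f -` box l r) \<in> lmeasurable"
      using R S by (rule measurable_orthogonal_image)
    have "?R ` (?f -` box l r) \<in> sets borel"
      by (subst img[symmetric]) (rule measurable_sets_borel[of _ borel], auto simp: B)
    moreover have "?f -` box l r \<in> sets borel" unfolding eq by simp
    moreover have em: "emeasure lborel X = ennreal (measure lebesgue X)"
      if "X \<in> lmeasurable" "X \<in> sets borel" for X :: "(real^2) set"
      using that emeasure_eq_measure2[of X lebesgue] by simp
    ultimately show ?thesis
      using measure_orthogonal_image[OF R S] em[OF S] em[OF RS] by (simp only: simp_thms)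
  qed
  also have "\<dots> = emeasure lborel (box l r)" by (rule m[symmetric]) simp
  finally show "emeasure (distr lborel borel (\<lambda>z. u * z)) (box l r) = (\<Prod>b\<in>Basis. (r - l) \<bullet> b)"
    using le by (simp add: emeasure_lborel_box_eq)
qed simp

lemma emeasure_affine_vimage:
  fixes p u :: complex
  assumes "norm u = 1" "S \<in> sets borel"
  shows "emeasure lborel {z. p + u * z \<in> S} = emeasure lborel S"
proof -
  have "emeasure lborel S = emeasure (distr (distr lborel borel (\<lambda>z. u * z)) borel (\<lambda>z. p + z)) S"
    using lborel_distr_rotation[OF assms(1)] lborel_distr_plus[of p] by simp
  also have "\<dots> = emeasure (distr lborel borel (\<lambda>z. p + u * z)) S"
    by (subst distr_distr) (auto simp: o_def)
  also have "\<dots> = emeasure lborel {z. p + u * z \<in> S}"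
    using assms(2) by (subst emeasure_distr) (auto simp: vimage_def)
  finally show ?thesis ..
qed

lemma measure_rotation_vimage:
  fixes u :: complex
  assumes "norm u = 1" "S \<in> sets borel"
  shows "measure lborel {z. u * z \<in> S} = measure lborel S"
  using emeasure_affine_vimage[OF assms, of 0] by (simp add: measure_def)

section \<open>Angular sectors and their measure\<close>

lemma borel_measurable_Arg2pi [measurable]: "Arg2pi \<in> borel_measurable borel"
  by (rule borel_measurableI_le) (auto simp: closed_Arg2pi2pi_le)

text \<open>Since \<open>Arg2pi 0 = 0\<close>, the origin belongs to every sector of positive width.\<close>

definition sector :: "real \<Rightarrow> real \<Rightarrow> complex set" where
  "sector a w = {z. Arg2pi (cis (- a) * z) < w}"

lemma sets_borel_sector [measurable]: "sector a w \<in> sets borel"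
  unfolding sector_def by measurable

lemma Arg2pi_cis:
  assumes "0 < \<rho>" "0 \<le> \<phi>" "\<phi> < 2 * pi"
  shows "Arg2pi (of_real \<rho> * cis \<phi>) = \<phi>"
  by (rule Arg2pi_unique[of \<rho>]) (use assms in \<open>auto simp: cis_conv_exp mult.commute\<close>)

lemma mem_sector_cis:
  assumes "0 < \<rho>" "a \<le> \<phi>" "\<phi> < a + 2 * pi"
  shows "of_real \<rho> * cis \<phi> \<in> sector a w \<longleftrightarrow> \<phi> < a + w"
proof -
  have "cis (- a) * (of_real \<rho> * cis \<phi>) = of_real \<rho> * cis (\<phi> - a)"
    by (simp add: cis_mult mult.left_commute)
  then have "Arg2pi (cis (- a) * (of_real \<rho> * cis \<phi>)) = \<phi> - a"
    using assms Arg2pi_cis[of \<rho> "\<phi> - a"] by (simp only:)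
  then show ?thesis by (auto simp: sector_def)
qed

text \<open>The window of angles may begin at any \<open>a\<close>, so each application can start it
  at the edge of the sector or arc in question, where membership is a comparison of angles.\<close>

lemma polar_form_from:
  assumes "z \<noteq> 0"
  obtains \<phi> where "a \<le> \<phi>" "\<phi> < a + 2 * pi" "z = of_real (cmod z) * cis \<phi>"
proof
  let ?y = "Arg2pi (cis (- a) * z)"
  show "a \<le> a + ?y" "a + ?y < a + 2 * pi" using Arg2pi_ge_0 Arg2pi_lt_2pi by auto
  have "cis (- a) * z = of_real (cmod z) * cis ?y"
    using Arg2pi_eq[of "cis (- a) * z"] by (simp add: norm_mult cis_conv_exp)
  then have "cis a * (cis (- a) * z) = cis a * (of_real (cmod z) * cis ?y)" by simp
  then show "z = of_real (cmod z) * cis (a + ?y)"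
    by (simp add: cis_mult[symmetric] mult_ac) (simp add: cis_mult flip: mult.assoc)
qed

text \<open>As a function of the angle, the measure is additive and monotone, hence linear.\<close>

lemma measure_sector:
  assumes K: "K \<in> sets borel" "bounded K" "0 \<notin> K"
    and inv: "\<And>u z. norm u = 1 \<Longrightarrow> u * z \<in> K \<longleftrightarrow> z \<in> K"
    and w: "0 \<le> w" "w \<le> 2 * pi"
  shows "measure lborel (K \<inter> sector a w) = w / (2 * pi) * measure lborel K"
proof -
  have fin: "emeasure lborel (K \<inter> sector a w) \<noteq> \<infinity>" for a w
  proof -
    have "emeasure lborel (K \<inter> sector a w) \<le> emeasure lborel K" using K by (intro emeasure_mono) auto
    also have "\<dots> < \<infinity>" using K emeasure_bounded_finite by auto
    finally show ?thesis by simp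
  qed
  have rot: "measure lborel (K \<inter> sector a w) = measure lborel (K \<inter> sector 0 w)" for a w
  proof -
    have "measure lborel (K \<inter> sector 0 w) = measure lborel {z. cis (- a) * z \<in> K \<inter> sector 0 w}"
      using K by (intro measure_rotation_vimage[symmetric]) auto
    also have "{z. cis (- a) * z \<in> K \<inter> sector 0 w} = K \<inter> sector a w"
      using inv by (auto simp: sector_def)
    finally show ?thesis ..
  qed
  define m where "m w = measure lborel (K \<inter> sector 0 w)" for w
  have add: "m (v + w) = m v + m w" if "0 \<le> v" "0 \<le> w" "v + w \<le> 2 * pi" for v w
  proof -
    have iff: "z \<in> sector 0 (v + w) \<longleftrightarrow> z \<in> sector 0 v \<or> z \<in> sector v w"
      and disj: "z \<notin> sector 0 v \<or> z \<notin> sector v w" if "z \<in> K" for z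
    proof -
      have "z \<noteq> 0" using \<open>z \<in> K\<close> K by auto
      then obtain \<phi> where \<phi>: "0 \<le> \<phi>" "\<phi> < 2 * pi" "z = of_real (cmod z) * cis \<phi>"
        using polar_form_from[of z 0] by auto
      have *: "z \<in> sector 0 x \<longleftrightarrow> \<phi> < x" for x
        using \<phi> \<open>z \<noteq> 0\<close> mem_sector_cis[of "cmod z" 0 \<phi> x] by auto
      show "z \<in> sector 0 (v + w) \<longleftrightarrow> z \<in> sector 0 v \<or> z \<in> sector v w"
        and "z \<notin> sector 0 v \<or> z \<notin> sector v w"
      proof (atomize(full), cases "v \<le> \<phi>")
        case True
        have "z \<in> sector v w \<longleftrightarrow> \<phi> < v + w"
          using \<phi> True that \<open>0 \<le> v\<close> \<open>z \<noteq> 0\<close> mem_sector_cis[of "cmod z" v \<phi> w] by auto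
        then show "(z \<in> sector 0 (v + w) \<longleftrightarrow> z \<in> sector 0 v \<or> z \<in> sector v w) \<and> (z \<notin> sector 0 v \<or> z \<notin> sector v w)"
          using True * by auto
      next
        \<comment> \<open>Below \<open>v\<close> the angle must be raised by a full turn to enter
          the window starting at \<open>v\<close>; it is then at least \<open>2 * pi\<close>, hence
          not below \<open>v + w\<close>.\<close>
        case False
        have "cis \<phi> = cis (\<phi> + 2 * pi)" by (simp add: cis.ctr complex_eq_iff)
        then have "z \<in> sector v w \<longleftrightarrow> \<phi> + 2 * pi < v + w"
          using \<phi> False \<open>z \<noteq> 0\<close> \<open>0 \<le> v\<close> \<open>0 \<le> w\<close> \<open>v + w \<le> 2 * pi\<close> mem_sector_cis[of "cmod z" v "\<phi> + 2 * pi" w] by auto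
        then show "(z \<in> sector 0 (v + w) \<longleftrightarrow> z \<in> sector 0 v \<or> z \<in> sector v w) \<and> (z \<notin> sector 0 v \<or> z \<notin> sector v w)"
          using False * \<phi> \<open>0 \<le> v\<close> \<open>0 \<le> w\<close> \<open>v + w \<le> 2 * pi\<close> by auto
      qed
    qed
    have "m (v + w) = measure lborel ((K \<inter> sector 0 v) \<union> (K \<inter> sector v w))"
      unfolding m_def by (rule arg_cong[where f = "measure lborel"]) (use iff in blast)
    also have "\<dots> = measure lborel (K \<inter> sector 0 v) + measure lborel (K \<inter> sector v w)"
    proof (rule measure_Union)
      show "K \<inter> sector 0 v \<inter> (K \<inter> sector v w) = {}" using disj by blast
    qed (simp_all only: fin not_False_eq_True sets_lborel sets_borel_sector sets.Int K)
    finally show ?thesis by (simp add: m_def rot[of v])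
  qed
  have m0: "m 0 = 0" using add[of 0 0] by simp
  have nonneg: "0 \<le> m v" for v by (simp add: m_def)
  have mono: "m v \<le> m w" if "0 \<le> v" "v \<le> w" "w \<le> 2 * pi" for v w
    using add[of v "w - v"] nonneg[of "w - v"] that by simp
  have full: "m (2 * pi) = measure lborel K"
    using Arg2pi_lt_2pi by (auto simp: m_def sector_def intro!: arg_cong[where f = "measure lborel"])
  let ?M = "measure lborel K"
  have mult: "m (real k * v) = real k * m v" if "0 \<le> v" "real k * v \<le> 2 * pi" for k v
    using that
  proof (induction k)
    case (Suc k)
    have "real k * v \<le> 2 * pi" using Suc.prems by (simp add: algebra_simps)
    with Suc add[of "real k * v" v] show ?case by (simp add: algebra_simps)
  qed (simp add: m0)
  \<comment> \<open>The full turn is cut into \<open>n\<close> equal sectors. Monotonicity puts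
    \<open>m w\<close> and its conjectured value into the same interval of length
    \<open>?M / real n\<close>, and \<open>n\<close> is arbitrary.\<close>
  have bound: "\<bar>m w - w / (2 * pi) * ?M\<bar> \<le> ?M / real n" if n: "n > 0" for n :: nat
  proof -
    define h where "h = 2 * pi / real n"
    have h: "h > 0" "real n * h = 2 * pi" using n by (auto simp: h_def)
    have mh: "m h = ?M / real n" using mult[of h n] h full n by (simp add: field_simps)
    have mk: "m (real k * h) = real k / real n * ?M" if "k \<le> n" for k
      using mult[of h k] h mh that mult_right_mono[of "real k" "real n" h] by (simp add: field_simps)
    show ?thesis
    \<comment> \<open>For \<open>w < 2 * pi\<close> the multiple \<open>Suc k\<close> of
      \<open>h\<close> still lies within one turn, where additivity applies.\<close>
    proof (cases "w = 2 * pi")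
      case True
      then show ?thesis using full n by simp
    next
      case False
      define k where "k = nat \<lfloor>w / h\<rfloor>"
      have k: "real k * h \<le> w" "w < real (Suc k) * h"
      proof -
        have "real k = of_int \<lfloor>w / h\<rfloor>" using w h by (simp add: k_def)
        then have "real k \<le> w / h" "w / h < real k + 1" by linarith+
        then show "real k * h \<le> w" "w < real (Suc k) * h" using h by (auto simp: field_simps)
      qed
      have "real k * h < real n * h" using k(1) h(2) w False by linarith
      then have kn: "k < n" using h(1) mult_less_cancel_right_pos[of h "real k" "real n"] by simp
      have "real (Suc k) * h \<le> real n * h" using kn h by (intro mult_right_mono) auto
      then have "m w \<le> m (real (Suc k) * h)" using k h w by (intro mono) auto
      moreover have "m (real k * h) \<le> m w" using k h w by (intro mono) auto
      ultimately have m: "real k / real n * ?M \<le> m w" "m w \<le> real (Suc k) / real n * ?M"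
        using mk[of k] mk[of "Suc k"] kn by auto
      have x: "real k / real n \<le> w / (2 * pi)" "w / (2 * pi) \<le> real (Suc k) / real n"
        using k n unfolding h_def by (auto simp: field_simps)
      have "real k / real n * ?M \<le> w / (2 * pi) * ?M" "w / (2 * pi) * ?M \<le> real (Suc k) / real n * ?M"
        using x by (intro mult_right_mono; simp)+
      moreover have "real (Suc k) / real n * ?M = real k / real n * ?M + ?M / real n"
        using n by (simp add: field_simps)
      ultimately show ?thesis using m by linarith
    qed
  qed
  have "(\<lambda>n. ?M / real n) \<longlonglongrightarrow> 0" by (rule lim_const_over_n)
  then have "\<bar>m w - w / (2 * pi) * ?M\<bar> \<le> 0"
    by (rule LIMSEQ_le_const) (use bound in \<open>auto intro!: exI[of _ 1]\<close>)
  then show ?thesis by (simp add: rot[of a] m_def)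
qed

section \<open>Thin annuli and the derivative of the area inside a disk\<close>

lemma measure_annulus:
  assumes "0 \<le> r" "r \<le> R"
  shows "measure lborel {z::complex. r < cmod z \<and> cmod z \<le> R} = pi * (R\<^sup>2 - r\<^sup>2)"
proof -
  have c: "measure lborel (cball (0::complex) x) = pi * x\<^sup>2" if "0 \<le> x" for x
    using that by (simp add: content_cball unit_ball_vol_2)
  have "{z::complex. r < cmod z \<and> cmod z \<le> R} = cball 0 R - cball 0 r" by auto
  moreover have "measure lborel (cball (0::complex) R - cball 0 r) = measure lborel (cball (0::complex) R) - measure lborel (cball (0::complex) r)"
    using assms emeasure_bounded_finite[of "cball (0::complex) R"] by (intro measure_Diff) auto
  ultimately show ?thesis using assms by (simp add: c algebra_simps)
qed

lemma measure_annulus_sector: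
  assumes "0 \<le> r" "r \<le> R" "0 \<le> w" "w \<le> 2 * pi"
  shows "measure lborel ({z::complex. r < cmod z \<and> cmod z \<le> R} \<inter> sector a w) = w / 2 * (R\<^sup>2 - r\<^sup>2)"
proof -
  have "bounded {z::complex. r < cmod z \<and> cmod z \<le> R}"
    by (rule bounded_subset[of "cball 0 R"]) auto
  moreover have "{z::complex. r < cmod z \<and> cmod z \<le> R} \<in> sets borel" by measurable
  ultimately show ?thesis
    using assms by (subst measure_sector) (auto simp: norm_mult measure_annulus)
qed

text \<open>The increment of the area between two radii is the area of \<open>E\<close> in a thin
  annulus. By continuity of \<alpha> and \<beta>, that part of \<open>E\<close> lies between two
  annular sectors whose widths differ from \<open>\<beta> r - \<alpha> r\<close> by at most
  \<open>2 * e\<close>.\<close>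

lemma measure_disk_derivative:
  assumes E: "E \<in> sets borel"
    and cont: "continuous_on {0<..<R} \<alpha>" "continuous_on {0<..<R} \<beta>"
    and ab: "\<And>\<rho>. \<rho> \<in> {0<..<R} \<Longrightarrow> \<alpha> \<rho> < \<beta> \<rho> \<and> \<beta> \<rho> < \<alpha> \<rho> + 2 * pi"
    and mem: "\<And>\<rho> \<phi>. \<lbrakk>\<rho> \<in> {0<..<R}; \<alpha> \<rho> \<le> \<phi>; \<phi> < \<alpha> \<rho> + 2 * pi\<rbrakk> \<Longrightarrow>
                of_real \<rho> * cis \<phi> \<in> E \<longleftrightarrow> \<phi> \<le> \<beta> \<rho>"
    and r: "r \<in> {0<..<R}"
  shows "((\<lambda>r. measure lborel (E \<inter> cball 0 r)) has_real_derivative r * (\<beta> r - \<alpha> r)) (at r)"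
proof -
  define A where "A r = measure lborel (E \<inter> cball 0 r)" for r
  let ?ann = "\<lambda>r R. {z::complex. r < cmod z \<and> cmod z \<le> R}"
  define \<theta> where "\<theta> = \<beta> r - \<alpha> r"
  have fin: "emeasure lborel S \<noteq> \<infinity>" if "S \<subseteq> cball (0::complex) x" for S x
  proof -
    have "emeasure lborel S \<le> emeasure lborel (cball (0::complex) x)" using that by (intro emeasure_mono) auto
    also have "\<dots> < \<infinity>" using emeasure_bounded_finite[of "cball (0::complex) x"] by simp
    finally show ?thesis by simp
  qed
  have ann_meas [measurable]: "?ann lo hi \<in> sets borel" for lo hi by measurable
  have fm: "E \<inter> ?ann lo hi \<in> fmeasurable lborel" "?ann lo hi \<inter> sector a w \<in> fmeasurable lborel" for lo hi a w
  proof -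
    have "S \<in> fmeasurable lborel" if "S \<subseteq> cball (0::complex) x" "S \<in> sets borel" for S x
      using fin[OF that(1)] that(2) by (intro fmeasurableI) (auto simp: less_top)
    moreover have "E \<inter> ?ann lo hi \<subseteq> cball 0 hi" "?ann lo hi \<inter> sector a w \<subseteq> cball 0 hi" by auto
    ultimately show "E \<inter> ?ann lo hi \<in> fmeasurable lborel" "?ann lo hi \<inter> sector a w \<in> fmeasurable lborel"
      using E ann_meas by (metis sets.Int sets_borel_sector)+
  qed
  have diff: "A hi - A lo = measure lborel (E \<inter> ?ann lo hi)" if "lo \<le> hi" for lo hi
  proof -
    have "E \<inter> ?ann lo hi = (E \<inter> cball 0 hi) - (E \<inter> cball 0 lo)" using that by auto
    moreover have "measure lborel ((E \<inter> cball 0 hi) - (E \<inter> cball 0 lo)) = A hi - A lo"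
      unfolding A_def using that E fin[of "E \<inter> cball 0 hi" hi] by (intro measure_Diff) auto
    ultimately show ?thesis by simp
  qed
  have squeeze: "\<bar>(A hi - A lo) - \<theta> / 2 * (hi\<^sup>2 - lo\<^sup>2)\<bar> \<le> e * (hi\<^sup>2 - lo\<^sup>2)"
    if lh: "0 < lo" "lo \<le> hi" "hi < R" and e: "0 < e" "2 * e \<le> \<theta>" "\<theta> + 2 * e \<le> 2 * pi"
      and near: "\<And>\<rho>. \<rho> \<in> {lo..hi} \<Longrightarrow> \<bar>\<alpha> \<rho> - \<alpha> r\<bar> < e \<and> \<bar>\<beta> \<rho> - \<beta> r\<bar> < e" for lo hi e
  proof -
    \<comment> \<open>The inner sector is cut back by \<open>e\<close> at both ends, so its angles
      stay between \<alpha> and \<beta> at every radius of the annulus; the outer sector below is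
      widened by \<open>e\<close> at both ends.\<close>
    have "?ann lo hi \<inter> sector (\<alpha> r + e) (\<theta> - 2 * e) \<subseteq> E \<inter> ?ann lo hi"
    proof
      fix z assume z: "z \<in> ?ann lo hi \<inter> sector (\<alpha> r + e) (\<theta> - 2 * e)"
      then have z0: "z \<noteq> 0" "cmod z \<in> {lo..hi}" "cmod z \<in> {0<..<R}" using lh by auto
      obtain \<phi> where \<phi>: "\<alpha> r + e \<le> \<phi>" "\<phi> < \<alpha> r + e + 2 * pi" "z = of_real (cmod z) * cis \<phi>"
        using polar_form_from[OF z0(1)] by blast
      then have "\<phi> < \<alpha> r + e + (\<theta> - 2 * e)"
        using z z0 mem_sector_cis[of "cmod z" "\<alpha> r + e" \<phi>] by auto
      then have "\<alpha> (cmod z) \<le> \<phi>" "\<phi> \<le> \<beta> (cmod z)"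
        using near[OF z0(2)] \<phi>(1) unfolding \<theta>_def by linarith+
      then have "z \<in> E" using mem[OF z0(3), of \<phi>] ab[OF z0(3)] \<phi>(3) by simp
      then show "z \<in> E \<inter> ?ann lo hi" using z by simp
    qed
    then have "measure lborel (?ann lo hi \<inter> sector (\<alpha> r + e) (\<theta> - 2 * e)) \<le> measure lborel (E \<inter> ?ann lo hi)"
      using fm by (intro measure_mono_fmeasurable) auto
    then have 1: "(\<theta> - 2 * e) / 2 * (hi\<^sup>2 - lo\<^sup>2) \<le> A hi - A lo"
      using lh e by (simp add: diff measure_annulus_sector)
    have "E \<inter> ?ann lo hi \<subseteq> ?ann lo hi \<inter> sector (\<alpha> r - e) (\<theta> + 2 * e)"
    proof
      fix z assume z: "z \<in> E \<inter> ?ann lo hi"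
      then have z0: "z \<noteq> 0" "cmod z \<in> {lo..hi}" "cmod z \<in> {0<..<R}" using lh by auto
      obtain \<phi> where \<phi>: "\<alpha> (cmod z) \<le> \<phi>" "\<phi> < \<alpha> (cmod z) + 2 * pi" "z = of_real (cmod z) * cis \<phi>"
        using polar_form_from[OF z0(1)] by blast
      then have "\<phi> \<le> \<beta> (cmod z)"
        using z z0 mem[OF z0(3), of \<phi>] by auto
      then have "\<alpha> r - e \<le> \<phi>" "\<phi> < \<alpha> r - e + (\<theta> + 2 * e)"
        using near[OF z0(2)] \<phi>(1) unfolding \<theta>_def by linarith+
      then have "z \<in> sector (\<alpha> r - e) (\<theta> + 2 * e)"
        using mem_sector_cis[of "cmod z" "\<alpha> r - e" \<phi>] z0 e \<phi>(3) by auto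
      then show "z \<in> ?ann lo hi \<inter> sector (\<alpha> r - e) (\<theta> + 2 * e)" using z by simp
    qed
    then have "measure lborel (E \<inter> ?ann lo hi) \<le> measure lborel (?ann lo hi \<inter> sector (\<alpha> r - e) (\<theta> + 2 * e))"
      using fm by (intro measure_mono_fmeasurable) (auto simp: E)
    then have 2: "A hi - A lo \<le> (\<theta> + 2 * e) / 2 * (hi\<^sup>2 - lo\<^sup>2)"
      using lh e by (simp add: diff measure_annulus_sector)
    show ?thesis using 1 2 by (simp add: abs_le_iff algebra_simps add_divide_distrib diff_divide_distrib)
  qed
  have q: "\<bar>(A y - A r) / (y - r) - \<theta> / 2 * (y + r)\<bar> \<le> e * (y + r)"
    if y: "y \<noteq> r" "0 < y" "y < R" and e: "0 < e" "2 * e \<le> \<theta>" "\<theta> + 2 * e \<le> 2 * pi"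
      and near: "\<And>\<rho>. \<rho> \<in> closed_segment y r \<Longrightarrow> \<bar>\<alpha> \<rho> - \<alpha> r\<bar> < e \<and> \<bar>\<beta> \<rho> - \<beta> r\<bar> < e" for y e
  proof -
    \<comment> \<open>Ordering the two radii treats increments to the left and to the right of
      \<open>r\<close> at once; the difference quotient is symmetric in them.\<close>
    define lo hi where "lo = min y r" and "hi = max y r"
    have lh: "0 < lo" "lo < hi" "hi < R" using y r by (auto simp: lo_def hi_def)
    have "{lo..hi} = closed_segment y r" by (auto simp: lo_def hi_def closed_segment_eq_real_ivl)
    then have "\<bar>(A hi - A lo) - \<theta> / 2 * (hi\<^sup>2 - lo\<^sup>2)\<bar> \<le> e * (hi\<^sup>2 - lo\<^sup>2)"
      using squeeze[of lo hi e] lh e near by auto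
    moreover have sq: "hi\<^sup>2 - lo\<^sup>2 = (hi - lo) * (hi + lo)" by (simp add: power2_eq_square algebra_simps)
    moreover have c: "(hi - lo) * ((A hi - A lo) / (hi - lo)) = A hi - A lo" using lh by simp
    moreover have "(hi - lo) * ((A hi - A lo) / (hi - lo) - \<theta> / 2 * (hi + lo)) = (A hi - A lo) - \<theta> / 2 * (hi\<^sup>2 - lo\<^sup>2)"
      by (subst right_diff_distrib) (simp only: c sq mult_ac)
    ultimately have "\<bar>(hi - lo) * ((A hi - A lo) / (hi - lo) - \<theta> / 2 * (hi + lo))\<bar> \<le> (hi - lo) * (e * (hi + lo))"
      by (simp only: mult_ac)
    then have "\<bar>(A hi - A lo) / (hi - lo) - \<theta> / 2 * (hi + lo)\<bar> \<le> e * (hi + lo)"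
      using lh by (simp add: abs_mult)
    moreover have "(A hi - A lo) / (hi - lo) = (A y - A r) / (y - r)" "hi + lo = y + r"
      using y(1) by (auto simp: lo_def hi_def min_def max_def field_simps)
    ultimately show ?thesis by simp
  qed
  have "((\<lambda>y. (A y - A r) / (y - r) - \<theta> / 2 * (y + r)) \<longlongrightarrow> 0) (at r)"
  proof (rule tendstoI)
    fix d :: real assume d: "0 < d"
    have R: "0 < R" "0 < r" "r < R" using r by auto
    have \<theta>: "0 < \<theta>" "\<theta> < 2 * pi" using ab[OF r] by (auto simp: \<theta>_def)
    \<comment> \<open>The first entry brings the final error \<open>e * (y + r)\<close> down to at
      most \<open>d / 2\<close>; the other two keep the inner width nonnegative and the outer width
      at most a full turn.\<close>
    define e where "e = Min {d / (4 * R), \<theta> / 2, (2 * pi - \<theta>) / 2}"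
    have e: "0 < e" "e \<le> d / (4 * R)" "2 * e \<le> \<theta>" "\<theta> + 2 * e \<le> 2 * pi"
    proof -
      have "e \<le> \<theta> / 2" "e \<le> (2 * pi - \<theta>) / 2" unfolding e_def by (rule Min.coboundedI; simp)+
      then show "2 * e \<le> \<theta>" "\<theta> + 2 * e \<le> 2 * pi" by (simp_all add: field_simps)
    qed (use \<theta> d R in \<open>simp_all add: e_def\<close>)
    have "isCont \<alpha> r" "isCont \<beta> r"
      using cont r by (auto simp: continuous_on_eq_continuous_at)
    then obtain s1 s2 where s: "s1 > 0" "s2 > 0"
        "\<And>x. dist x r < s1 \<Longrightarrow> dist (\<alpha> x) (\<alpha> r) < e" "\<And>x. dist x r < s2 \<Longrightarrow> dist (\<beta> x) (\<beta> r) < e"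
      using e(1) unfolding continuous_at_eps_delta dist_real_def by metis
    define s where "s = Min {s1, s2, r, R - r}"
    have s': "0 < s" "s \<le> s1" "s \<le> s2" "s \<le> r" "s \<le> R - r" using s R by (auto simp: s_def)
    show "\<forall>\<^sub>F y in at r. dist ((A y - A r) / (y - r) - \<theta> / 2 * (y + r)) 0 < d"
      unfolding eventually_at
    proof (intro exI[of _ s] conjI ballI impI s'(1))
      fix y assume y: "y \<noteq> r \<and> dist y r < s"
      have ys: "dist x r < s" if "x \<in> closed_segment y r" for x
        using that y by (auto simp: closed_segment_eq_real_ivl dist_real_def split: if_splits)
      have y': "0 < y" "y < R" using y s' by (auto simp: dist_real_def)
      have "\<bar>(A y - A r) / (y - r) - \<theta> / 2 * (y + r)\<bar> \<le> e * (y + r)"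
      proof (rule q)
        fix \<rho> assume "\<rho> \<in> closed_segment y r"
        then show "\<bar>\<alpha> \<rho> - \<alpha> r\<bar> < e \<and> \<bar>\<beta> \<rho> - \<beta> r\<bar> < e"
          using ys[of \<rho>] s(3,4)[of \<rho>] s' by (auto simp: dist_real_def)
      qed (use y y' e in auto)
      also have "\<dots> \<le> d / (4 * R) * (2 * R)"
        using e y' R d by (intro mult_mono) auto
      also have "\<dots> < d" using d R by simp
      finally show "dist ((A y - A r) / (y - r) - \<theta> / 2 * (y + r)) 0 < d" by (simp add: dist_real_def)
    qed
  qed
  moreover have "((\<lambda>y. \<theta> / 2 * (y + r)) \<longlongrightarrow> \<theta> / 2 * (r + r)) (at r)" by (intro tendsto_intros)
  ultimately have "((\<lambda>y. ((A y - A r) / (y - r) - \<theta> / 2 * (y + r)) + \<theta> / 2 * (y + r)) \<longlongrightarrow> 0 + \<theta> / 2 * (r + r)) (at r)"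
    by (rule tendsto_add)
  then have "((\<lambda>y. (A y - A r) / (y - r)) \<longlongrightarrow> r * (\<beta> r - \<alpha> r)) (at r)"
    by (simp add: \<theta>_def mult.commute)
  then show ?thesis unfolding A_def[symmetric] has_field_derivative_iff .
qed

section \<open>A branch of the curve in polar coordinates\<close>

text \<open>Chain rule with derivative 1 of \<open>arctan\<close> at 0. Resetting \<open>q\<close>
  to 0 at the origin turns the hypothesis into a one-sided derivative.\<close>

lemma arctan_has_right_derivative:
  assumes "((\<lambda>t. q t / t) \<longlongrightarrow> m) (at_right (0::real))"
  shows "((\<lambda>t. arctan (q t) / t) \<longlongrightarrow> m) (at_right 0)"
proof -
  define Q where "Q t = (if t = 0 then 0 else q t)" for t
  have "(Q has_real_derivative m) (at 0 within {0<..})"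
    unfolding has_field_derivative_iff
    using assms by (rule Lim_transform_eventually) (auto simp: Q_def eventually_at_filter)
  then have "((\<lambda>t. arctan (Q t)) has_real_derivative m) (at 0 within {0<..})"
    using DERIV_chain'[of Q m 0 "{0<..}" arctan 1] DERIV_arctan[of "Q 0"] by (simp add: Q_def)
  then have "((\<lambda>t. (arctan (Q t) - arctan (Q 0)) / (t - 0)) \<longlongrightarrow> m) (at_right 0)"
    by (simp add: has_field_derivative_iff)
  then show ?thesis
    by (rule Lim_transform_eventually) (auto simp: Q_def eventually_at_filter)
qed

text \<open>A curve leaving the origin with velocity 1, so that \<open>Im b\<close> is its signed
  curvature there. It is instantiated by the boundary run forwards and, after a half turn,
  backwards. The bound 1/10 keeps the branch in a narrow cone about the positive real axis and makes
  its modulus increase.\<close>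

locale unit_germ =
  fixes d d' :: "real \<Rightarrow> complex" and b :: complex and \<delta> :: real
  assumes deriv: "\<And>t. (d has_vector_derivative d' t) (at t)"
    and zero: "d 0 = 0"
    and unit: "d' 0 = 1"
    and second: "(d' has_vector_derivative b) (at 0)"
    and \<delta>_pos: "0 < \<delta>"
    and near: "\<And>t. \<bar>t\<bar> \<le> \<delta> \<Longrightarrow> cmod (d' t - 1) \<le> 1 / 10"
begin

text \<open>Mean value inequality for \<open>d t - of_real t\<close>, whose derivative
  \<open>d' t - 1\<close> is bounded by \<open>near\<close>.\<close>

lemma chord:
  assumes "\<bar>s\<bar> \<le> \<delta>" "\<bar>t\<bar> \<le> \<delta>"
  shows "cmod (d t - d s - of_real (t - s)) \<le> \<bar>t - s\<bar> / 10"
proof -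
  have "cmod ((d t - of_real t) - (d s - of_real s)) \<le> 1 / 10 * \<bar>t - s\<bar>"
  proof -
    have "norm ((\<lambda>t. d t - of_real t) t - (\<lambda>t. d t - of_real t) s) \<le> 1 / 10 * norm (t - s)"
    proof (rule differentiable_bound[of "{-\<delta>..\<delta>}" "\<lambda>t. d t - of_real t" "\<lambda>t h. h *\<^sub>R (d' t - 1)" "1 / 10"])
      fix x assume x: "x \<in> {-\<delta>..\<delta>}"
      have "((\<lambda>t. d t - of_real t) has_vector_derivative (d' x - 1)) (at x)"
        by (auto intro!: derivative_eq_intros deriv)
      then show "((\<lambda>t. d t - of_real t) has_derivative (\<lambda>h. h *\<^sub>R (d' x - 1))) (at x within {-\<delta>..\<delta>})"
        by (simp add: has_vector_derivative_def has_derivative_at_withinI)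
      have near_x: "cmod (d' x - 1) \<le> 1 / 10" using near[of x] x by auto
      show "onorm (\<lambda>h. h *\<^sub>R (d' x - 1)) \<le> 1 / 10"
      proof (rule onorm_le)
        fix h :: real
        show "norm (h *\<^sub>R (d' x - 1)) \<le> 1 / 10 * norm h"
          using near_x mult_left_mono[of "cmod (d' x - 1)" "1 / 10" "\<bar>h\<bar>"] by simp
      qed
    qed (use assms in auto)
    then show ?thesis by simp
  qed
  then show ?thesis by (simp add: algebra_simps)
qed

lemma near_line:
  assumes "\<bar>t\<bar> \<le> \<delta>"
  shows "cmod (d t - of_real t) \<le> \<bar>t\<bar> / 10"
  using chord[of 0 t] assms \<delta>_pos by (simp add: zero)

lemma Re_ge:
  assumes "0 \<le> t" "t \<le> \<delta>"
  shows "9 / 10 * t \<le> Re (d t)"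
  using near_line[of t] abs_Re_le_cmod[of "d t - of_real t"] assms by simp

lemma abs_Im_le:
  assumes "0 \<le> t" "t \<le> \<delta>"
  shows "\<bar>Im (d t)\<bar> \<le> t / 10"
  using near_line[of t] abs_Im_le_cmod[of "d t - of_real t"] assms by simp

text \<open>Expand the square of the modulus of \<open>d t = d s + (d t - d s)\<close>. The mixed
  term is an inner product of two vectors in the cone about the positive real axis, hence
  nonnegative, and the square of the increment is positive.\<close>

lemma norm_strict_mono:
  assumes "0 \<le> s" "s < t" "t \<le> \<delta>"
  shows "cmod (d s) < cmod (d t)"
proof -
  define e where "e = d t - d s - of_real (t - s)"
  have e: "cmod e \<le> (t - s) / 10" using chord[of s t] assms by (simp add: e_def)
  have "\<bar>Re e\<bar> \<le> (t - s) / 10" "\<bar>Im e\<bar> \<le> (t - s) / 10"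
    using e abs_Re_le_cmod[of e] abs_Im_le_cmod[of e] by linarith+
  then have r: "9 / 10 * (t - s) \<le> Re (d t - d s)" and i: "\<bar>Im (d t - d s)\<bar> \<le> (t - s) / 10"
  proof -
    assume *: "\<bar>Re e\<bar> \<le> (t - s) / 10" "\<bar>Im e\<bar> \<le> (t - s) / 10"
    have "Re e = Re (d t - d s) - (t - s)" "Im e = Im (d t - d s)" by (simp_all add: e_def)
    then show "9 / 10 * (t - s) \<le> Re (d t - d s)" and "\<bar>Im (d t - d s)\<bar> \<le> (t - s) / 10"
      using * unfolding abs_le_iff by argo+
  qed
  have "(9 / 10 * s) * (9 / 10 * (t - s)) \<le> Re (d s) * Re (d t - d s)"
    using r Re_ge[of s] assms by (intro mult_mono) auto
  moreover have "\<bar>Im (d s) * Im (d t - d s)\<bar> \<le> (s / 10) * ((t - s) / 10)"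
    unfolding abs_mult using i abs_Im_le[of s] assms by (intro mult_mono) auto
  moreover have "(9 / 10 * s) * (9 / 10 * (t - s)) - (s / 10) * ((t - s) / 10) = 8 / 10 * (s * (t - s))"
    by (simp add: field_simps)
  moreover have "0 \<le> s * (t - s)" using assms by simp
  ultimately have "0 \<le> Re (d s) * Re (d t - d s) + Im (d s) * Im (d t - d s)" by linarith
  moreover have "0 < (Re (d t - d s))\<^sup>2" using r assms by simp
  moreover have "(cmod (d t))\<^sup>2 = (cmod (d s))\<^sup>2 + 2 * (Re (d s) * Re (d t - d s) + Im (d s) * Im (d t - d s))
      + (Re (d t - d s))\<^sup>2 + (Im (d t - d s))\<^sup>2"
    unfolding cmod_power2 by (simp add: power2_eq_square algebra_simps)
  moreover have sum: "y < x" if "0 \<le> p" "0 < q" "0 \<le> r" "x = y + 2 * p + q + r" for p q r x y :: real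
    using that by linarith
  ultimately have "(cmod (d s))\<^sup>2 < (cmod (d t))\<^sup>2"
    using zero_le_power2[of "Im (d t - d s)"] sum by metis
  then show ?thesis by (rule power_less_imp_less_base) simp
qed

lemma continuous_d: "continuous_on S d"
  by (meson continuous_on_eq_continuous_within deriv has_vector_derivative_continuous has_vector_derivative_at_within)

lemma tendsto_Re_over: "((\<lambda>t. Re (d t) / t) \<longlongrightarrow> 1) (at_right 0)"
proof -
  have "((\<lambda>t. Re (d t)) has_real_derivative 1) (at 0)"
    using has_field_derivative_Re[OF deriv[of 0]] by (simp add: unit)
  then have "((\<lambda>t. Re (d t) / t) \<longlongrightarrow> 1) (at 0)"
    by (simp add: has_field_derivative_iff zero)
  then show ?thesis by (rule tendsto_within_subset) auto
qed

text \<open>After one use of L'Hospital, \<open>Im (d' t) / t\<close> is the difference quotient of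
  \<open>Im d'\<close> at 0, because \<open>d' 0 = 1\<close> is real; its limit comes from
  \<open>second\<close>.\<close>

lemma tendsto_Im_over_square: "((\<lambda>t. Im (d t) / t\<^sup>2) \<longlongrightarrow> Im b / 2) (at_right 0)"
proof (rule lhopital_right_0)
  have "continuous (at 0) d" using continuous_d[of UNIV] by (simp add: continuous_on_eq_continuous_at)
  then have "((\<lambda>t. Im (d t)) \<longlongrightarrow> Im (d 0)) (at 0)" by (intro tendsto_intros) (simp add: continuous_at)
  then have "((\<lambda>t. Im (d t)) \<longlongrightarrow> 0) (at 0)" by (simp add: zero)
  then show "((\<lambda>t. Im (d t)) \<longlongrightarrow> 0) (at_right 0)" by (rule tendsto_within_subset) auto
  show "((\<lambda>t. t\<^sup>2) \<longlongrightarrow> 0) (at_right (0::real))" by real_asymp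
  show "\<forall>\<^sub>F t in at_right 0. t\<^sup>2 \<noteq> (0::real)" "\<forall>\<^sub>F t in at_right 0. 2 * t \<noteq> (0::real)"
    by (auto simp: eventually_at_filter)
  show "\<forall>\<^sub>F t in at_right 0. ((\<lambda>t. Im (d t)) has_real_derivative Im (d' t)) (at t)"
    by (intro always_eventually allI has_field_derivative_Im deriv)
  show "\<forall>\<^sub>F t in at_right 0. ((\<lambda>t. t\<^sup>2) has_real_derivative 2 * t) (at t)"
    by (intro always_eventually allI) (auto intro!: derivative_eq_intros)
  have "((\<lambda>t. Im (d' t)) has_real_derivative Im b) (at 0)"
    by (rule has_field_derivative_Im[OF second])
  then have "((\<lambda>t. Im (d' t) / t) \<longlongrightarrow> Im b) (at 0)"
    by (simp add: has_field_derivative_iff unit)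
  then have "((\<lambda>t. Im (d' t) / t / 2) \<longlongrightarrow> Im b / 2) (at_right 0)"
    by (intro tendsto_divide tendsto_const) (auto elim: tendsto_within_subset)
  then show "((\<lambda>t. Im (d' t) / (2 * t)) \<longlongrightarrow> Im b / 2) (at_right 0)"
    by (simp add: field_simps)
qed

definition radius :: real where "radius = cmod (d \<delta>)"

text \<open>For \<rho> in \<open>{0..radius}\<close>, the time at which the branch crosses the
  circle of radius \<rho>, unique by \<open>inj_norm\<close>.\<close>

definition hit :: "real \<Rightarrow> real" where "hit = inv_into {0..\<delta>} (\<lambda>t. cmod (d t))"

definition angle :: "real \<Rightarrow> real" where
  "angle \<rho> = arctan (Im (d (hit \<rho>)) / Re (d (hit \<rho>)))"

lemma inj_norm: "inj_on (\<lambda>t. cmod (d t)) {0..\<delta>}"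
proof (rule linorder_inj_onI')
  fix s t assume "s \<in> {0..\<delta>}" "t \<in> {0..\<delta>}" "s < t"
  then show "cmod (d s) \<noteq> cmod (d t)" using norm_strict_mono[of s t] by auto
qed

lemma radius_pos: "0 < radius"
  using norm_strict_mono[of 0 \<delta>] \<delta>_pos by (simp add: radius_def zero)

lemma image_norm: "(\<lambda>t. cmod (d t)) ` {0..\<delta>} = {0..radius}"
proof (intro equalityI subsetI)
  fix \<rho> assume "\<rho> \<in> (\<lambda>t. cmod (d t)) ` {0..\<delta>}"
  then obtain t where t: "0 \<le> t" "t \<le> \<delta>" "\<rho> = cmod (d t)" by auto
  then show "\<rho> \<in> {0..radius}"
    using norm_strict_mono[of t \<delta>] by (cases "t = \<delta>") (auto simp: radius_def)
next
  fix \<rho> assume "\<rho> \<in> {0..radius}"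
  then have "\<exists>t\<ge>0. t \<le> \<delta> \<and> cmod (d t) = \<rho>"
    using \<delta>_pos continuous_d by (intro IVT') (auto simp: radius_def zero intro!: continuous_intros)
  then show "\<rho> \<in> (\<lambda>t. cmod (d t)) ` {0..\<delta>}" by auto
qed

lemma hit_in:
  assumes "\<rho> \<in> {0..radius}"
  shows "hit \<rho> \<in> {0..\<delta>}" and norm_hit: "cmod (d (hit \<rho>)) = \<rho>"
  using assms image_norm unfolding hit_def
  by (metis inv_into_into) (metis (no_types, lifting) assms f_inv_into_f image_norm)

lemma hit_norm: "t \<in> {0..\<delta>} \<Longrightarrow> hit (cmod (d t)) = t"
  unfolding hit_def by (rule inv_into_f_f[OF inj_norm])

lemma hit_pos:
  assumes "\<rho> \<in> {0<..radius}"
  shows "0 < hit \<rho>"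
  using hit_in[of \<rho>] norm_hit[of \<rho>] assms zero by (cases "hit \<rho> = 0") auto

lemma continuous_hit: "continuous_on {0..radius} hit"
proof -
  have "continuous_on ((\<lambda>t. cmod (d t)) ` {0..\<delta>}) hit"
    using hit_norm by (intro continuous_on_inv) (auto intro!: continuous_intros continuous_d)
  then show ?thesis by (simp add: image_norm)
qed

lemma continuous_angle: "continuous_on {0<..<radius} angle"
proof -
  have h: "continuous_on {0<..<radius} hit"
    by (rule continuous_on_subset[OF continuous_hit]) auto
  have "continuous_on {0<..<radius} (\<lambda>\<rho>. d (hit \<rho>))"
    by (rule continuous_on_compose2[OF continuous_d[of UNIV] h]) auto
  moreover have "Re (d (hit \<rho>)) \<noteq> 0" if "\<rho> \<in> {0<..<radius}" for \<rho>
    using Re_ge[of "hit \<rho>"] hit_pos[of \<rho>] hit_in[of \<rho>] that by auto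
  ultimately show ?thesis
    unfolding angle_def by (intro continuous_intros) auto
qed

lemma d_hit:
  assumes "\<rho> \<in> {0<..radius}"
  shows "d (hit \<rho>) = of_real \<rho> * cis (angle \<rho>)" and abs_angle: "\<bar>angle \<rho>\<bar> < pi / 4"
proof -
  let ?z = "d (hit \<rho>)"
  have h: "0 < hit \<rho>" "hit \<rho> \<le> \<delta>" "cmod ?z = \<rho>"
    using hit_pos[OF assms] hit_in(1)[of \<rho>] norm_hit[of \<rho>] assms by auto
  then have re: "0 < Re ?z" "\<bar>Im ?z\<bar> < Re ?z"
    using Re_ge[of "hit \<rho>"] abs_Im_le[of "hit \<rho>"] by linarith+
  have "Arg ?z = angle \<rho>" using re(1) by (simp add: angle_def arg_conv_arctan)
  then show "?z = of_real \<rho> * cis (angle \<rho>)"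
    using h(3) rcis_cmod_Arg[of ?z] by (simp add: rcis_def)
  have "\<bar>Im ?z / Re ?z\<bar> < 1" using re by simp
  then have "- 1 < Im ?z / Re ?z" "Im ?z / Re ?z < 1" by linarith+
  then have "arctan (-1) < angle \<rho>" "angle \<rho> < arctan 1"
    unfolding angle_def by (simp_all only: arctan_less_iff)
  then show "\<bar>angle \<rho>\<bar> < pi / 4" by (simp add: arctan_one arctan_minus)
qed

lemma filterlim_hit: "filterlim hit (at_right 0) (at_right 0)"
proof -
  have "(hit \<longlongrightarrow> hit 0) (at 0 within {0..radius})"
    using continuous_hit radius_pos by (auto simp: continuous_on_def)
  moreover have "hit 0 = 0" using hit_norm[of 0] \<delta>_pos by (simp add: zero)
  moreover have "at 0 within {0..radius} = at_right (0::real)"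
    using radius_pos at_within_Icc_at_right by blast
  ultimately have "(hit \<longlongrightarrow> 0) (at_right 0)" by simp
  moreover have "\<forall>\<^sub>F \<rho> in at_right 0. hit \<rho> \<in> {0<..} \<and> hit \<rho> \<noteq> 0"
    using hit_pos radius_pos by (force simp: eventually_at_right_field intro!: exI[of _ radius])
  ultimately show ?thesis by (simp add: filterlim_at)
qed

text \<open>In the time variable, \<open>Im (d t)\<close> is about \<open>Im b / 2 * t^2\<close> and
  \<open>Re (d t)\<close> about \<open>t\<close>, so the angle is about \<open>Im b / 2 * t\<close>.
  Since \<open>cmod (d t) / t\<close> tends to 1, time may be replaced by radius.\<close>

lemma tendsto_angle: "((\<lambda>\<rho>. angle \<rho> / \<rho>) \<longlongrightarrow> Im b / 2) (at_right 0)"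
proof -
  have q: "((\<lambda>t. (Im (d t) / Re (d t)) / t) \<longlongrightarrow> Im b / 2) (at_right 0)"
  proof -
    have "((\<lambda>t. (Im (d t) / t\<^sup>2) / (Re (d t) / t)) \<longlongrightarrow> (Im b / 2) / 1) (at_right 0)"
      by (intro tendsto_divide tendsto_Re_over tendsto_Im_over_square) simp
    then show ?thesis
      by (auto elim!: Lim_transform_eventually simp: eventually_at_filter power2_eq_square)
  qed
  have "((\<lambda>t. arctan (Im (d t) / Re (d t)) / t) \<longlongrightarrow> Im b / 2) (at_right 0)"
    by (rule arctan_has_right_derivative[OF q])
  then have 1: "((\<lambda>\<rho>. angle \<rho> / hit \<rho>) \<longlongrightarrow> Im b / 2) (at_right 0)"
    unfolding angle_def by (rule filterlim_compose[OF _ filterlim_hit])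
  \<comment> \<open>Splitting \<open>Im (d t) / t\<close> as \<open>Im (d t) / t\<^sup>2 * t\<close>
    shows through the known limit that it tends to 0.\<close>
  have "((\<lambda>t. sqrt ((Re (d t) / t)\<^sup>2 + (Im (d t) / t\<^sup>2 * t)\<^sup>2)) \<longlongrightarrow> sqrt (1\<^sup>2 + (Im b / 2 * 0)\<^sup>2)) (at_right 0)"
    by (intro tendsto_intros tendsto_Re_over tendsto_Im_over_square)
  moreover have "\<forall>\<^sub>F t in at_right 0. sqrt ((Re (d t) / t)\<^sup>2 + (Im (d t) / t\<^sup>2 * t)\<^sup>2) = cmod (d t) / t"
      unfolding eventually_at_filter
    proof (intro always_eventually allI impI)
      fix t :: real assume t: "t \<noteq> 0" "t \<in> {0<..}"
      have "(Re (d t) / t)\<^sup>2 + (Im (d t) / t\<^sup>2 * t)\<^sup>2 = (cmod (d t) / t)\<^sup>2"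
        unfolding power_divide cmod_power2 using t by (simp add: power2_eq_square add_divide_distrib)
      then show "sqrt ((Re (d t) / t)\<^sup>2 + (Im (d t) / t\<^sup>2 * t)\<^sup>2) = cmod (d t) / t"
        using t by simp
    qed
  ultimately have "((\<lambda>t. cmod (d t) / t) \<longlongrightarrow> sqrt (1\<^sup>2 + (Im b / 2 * 0)\<^sup>2)) (at_right 0)"
    by (rule Lim_transform_eventually)
  then have "((\<lambda>t. cmod (d t) / t) \<longlongrightarrow> 1) (at_right 0)" by simp
  then have "((\<lambda>\<rho>. cmod (d (hit \<rho>)) / hit \<rho>) \<longlongrightarrow> 1) (at_right 0)"
    by (rule filterlim_compose[OF _ filterlim_hit])
  moreover have "\<forall>\<^sub>F \<rho> in at_right 0. cmod (d (hit \<rho>)) / hit \<rho> = \<rho> / hit \<rho>"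
    using norm_hit radius_pos by (force simp: eventually_at_right_field intro!: exI[of _ radius])
  ultimately have "((\<lambda>\<rho>. \<rho> / hit \<rho>) \<longlongrightarrow> 1) (at_right 0)"
    by (rule Lim_transform_eventually)
  then have "((\<lambda>\<rho>. (angle \<rho> / hit \<rho>) / (\<rho> / hit \<rho>)) \<longlongrightarrow> (Im b / 2) / 1) (at_right 0)"
    by (intro tendsto_divide 1) auto
  moreover have "\<forall>\<^sub>F \<rho> in at_right 0. (angle \<rho> / hit \<rho>) / (\<rho> / hit \<rho>) = angle \<rho> / \<rho>"
    using hit_pos radius_pos
    by (force simp: eventually_at_right_field intro!: exI[of _ radius])
  ultimately show ?thesis by (auto elim: Lim_transform_eventually)
qed

end

section \<open>The density of the region at a boundary point in normal position\<close>

lemma eventually_at_right_0_interval: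
  fixes R :: real
  assumes "0 < R"
  shows "\<forall>\<^sub>F r in at_right 0. r \<in> {0<..<R}"
  using assms by (auto simp: eventually_at_right_field)

text \<open>Differentiability is a separate conjunct because \<open>deriv\<close> is total and has
  an unspecified value where no derivative exists.\<close>

definition right_slope_limit :: "(real \<Rightarrow> real) \<Rightarrow> real \<Rightarrow> bool" where
  "right_slope_limit F l \<longleftrightarrow>
     (\<forall>\<^sub>F r in at_right 0. F field_differentiable (at r)) \<and> (deriv F \<longlongrightarrow> l) (at_right 0)"

text \<open>A derivative at \<open>r\<close> depends only on the function near \<open>r\<close>, and
  limits at 0 from the right are unique. This serves twice: to compare two regions with the same
  areas, and to compare two parameterizations of one boundary.\<close>

lemma right_slope_limit_unique:
  assumes F: "right_slope_limit F l" and F': "right_slope_limit F' l'"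
    and e: "0 < e" "\<And>r. r \<in> {0<..<e} \<Longrightarrow> F r = F' r"
  shows "l = l'"
proof -
  have "\<forall>\<^sub>F r in at_right 0. deriv F r = deriv F' r"
    using eventually_at_right_0_interval[OF e(1)]
  proof eventually_elim
    case (elim r)
    have "\<forall>\<^sub>F x in nhds r. x \<in> {0<..<e}" using elim by (intro eventually_nhds_in_open) auto
    then have "\<forall>\<^sub>F x in nhds r. F x = F' x" by eventually_elim (rule e(2))
    then show ?case by (intro deriv_cong_ev refl)
  qed
  then have "(deriv F' \<longlongrightarrow> l) (at_right 0)"
    using F Lim_transform_eventually unfolding right_slope_limit_def by blast
  then show ?thesis
    using F' tendsto_unique trivial_limit_at_right_real unfolding right_slope_limit_def by blast
qed

lemma density_derivative:
  fixes A \<theta> :: "real \<Rightarrow> real"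
  assumes R: "0 < R"
    and A': "\<And>r. r \<in> {0<..<R} \<Longrightarrow> (A has_real_derivative r * \<theta> r) (at r)"
    and A0: "(A \<longlongrightarrow> 0) (at_right 0)"
    and \<theta>: "((\<lambda>r. (\<theta> r - pi) / r) \<longlongrightarrow> - k) (at_right 0)"
  shows "right_slope_limit (\<lambda>\<rho>. A \<rho> / (pi * \<rho>\<^sup>2)) (- k / (3 * pi))" (is "right_slope_limit ?F _")
proof -
  \<comment> \<open>The quotient rule, with \<open>A' r = r * \<theta> r\<close> inserted. Both
    terms of \<open>G\<close> may blow up like 1/r; taking \<open>pi\<close> off \<theta> and
    \<open>pi * r\<^sup>2 / 2\<close> off \<open>A\<close> cancels exactly these parts.\<close>
  define G where "G r = \<theta> r / (pi * r) - 2 * A r / (pi * r ^ 3)" for r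
  have G: "((\<lambda>\<rho>. A \<rho> / (pi * \<rho>\<^sup>2)) has_real_derivative G r) (at r)" if r: "r \<in> {0<..<R}" for r
    using r by (auto intro!: derivative_eq_intros A' simp: G_def field_simps power2_eq_square power3_eq_cube)
  note ev = eventually_at_right_0_interval[OF R]
  have "((\<lambda>r. (A r - pi * r\<^sup>2 / 2) / r ^ 3) \<longlongrightarrow> - k / 3) (at_right 0)" (is "(?q \<longlongrightarrow> _) _")
  proof (rule lhopital_right_0)
    have "((\<lambda>r. pi * r\<^sup>2 / 2) \<longlongrightarrow> 0) (at_right (0::real))" by real_asymp
    from tendsto_diff[OF A0 this] show "((\<lambda>r. A r - pi * r\<^sup>2 / 2) \<longlongrightarrow> 0) (at_right 0)" by simp
    show "((\<lambda>r. r ^ 3) \<longlongrightarrow> 0) (at_right (0::real))" by real_asymp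
    show "\<forall>\<^sub>F r in at_right 0. r ^ 3 \<noteq> (0::real)" "\<forall>\<^sub>F r in at_right 0. 3 * r\<^sup>2 \<noteq> (0::real)"
      by (auto simp: eventually_at_filter)
    show "\<forall>\<^sub>F r in at_right 0. ((\<lambda>r. A r - pi * r\<^sup>2 / 2) has_real_derivative r * \<theta> r - pi * r) (at r)"
      using ev by eventually_elim (auto intro!: derivative_eq_intros A')
    show "\<forall>\<^sub>F r in at_right 0. ((\<lambda>r. r ^ 3) has_real_derivative 3 * r\<^sup>2) (at r)"
      by (intro always_eventually allI) (auto intro!: derivative_eq_intros)
    have "((\<lambda>r. (\<theta> r - pi) / r / 3) \<longlongrightarrow> - k / 3) (at_right 0)"
      by (intro tendsto_divide \<theta> tendsto_const) simp
    then show "((\<lambda>r. (r * \<theta> r - pi * r) / (3 * r\<^sup>2)) \<longlongrightarrow> - k / 3) (at_right 0)"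
      by (rule Lim_transform_eventually) (auto simp: eventually_at_filter field_simps power2_eq_square)
  qed
  moreover have "((\<lambda>r. (\<theta> r - pi) / r / pi) \<longlongrightarrow> - k / pi) (at_right 0)"
    by (intro tendsto_divide \<theta> tendsto_const) simp
  ultimately have "((\<lambda>r. (\<theta> r - pi) / r / pi - 2 / pi * ((A r - pi * r\<^sup>2 / 2) / r ^ 3)) \<longlongrightarrow> - k / pi - 2 / pi * (- k / 3)) (at_right 0)"
    by (intro tendsto_diff tendsto_mult tendsto_const)
  moreover have "- k / pi - 2 / pi * (- k / 3) = - k / (3 * pi)" by (simp add: field_simps)
  moreover have "\<forall>\<^sub>F r in at_right 0. (\<theta> r - pi) / r / pi - 2 / pi * ((A r - pi * r\<^sup>2 / 2) / r ^ 3) = G r"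
    by (auto simp: eventually_at_filter G_def field_simps power2_eq_square power3_eq_cube)
  ultimately have "(G \<longlongrightarrow> - k / (3 * pi)) (at_right 0)"
    by (simp add: Lim_transform_eventually)
  moreover have "\<forall>\<^sub>F r in at_right 0. G r = deriv ?F r"
    using ev by eventually_elim (metis G DERIV_imp_deriv)
  ultimately have "(deriv ?F \<longlongrightarrow> - k / (3 * pi)) (at_right 0)"
    by (rule Lim_transform_eventually)
  moreover have "\<forall>\<^sub>F r in at_right 0. ?F field_differentiable (at r)"
    using ev by eventually_elim (metis G field_differentiable_def)
  ultimately show ?thesis by (simp add: right_slope_limit_def)
qed

section \<open>Small circles about a boundary point in normal position\<close>

lemma cis_3_pi_half: "cis (3 * pi / 2) = - \<i>"
proof -
  have "3 * pi / 2 = pi + pi / 2" by simp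
  then show ?thesis by (simp only: flip: cis_mult) simp
qed

lemma cis_eq_imp_eq:
  assumes "cis x = cis y" "\<bar>x - y\<bar> < 2 * pi"
  shows "x = y"
proof -
  have "cis (x - y) = 1" using assms(1) by (simp flip: cis_divide)
  then have "cos (x - y) = 1" by (metis cis.sel(1) one_complex.sel(1))
  then obtain n :: int where n: "x - y = of_int n * 2 * pi" using cos_one_2pi_int by blast
  have "\<bar>of_int n :: real\<bar> * (2 * pi) < 1 * (2 * pi)"
    using assms(2) unfolding n by (simp add: abs_mult)
  then have "\<bar>of_int n :: real\<bar> < 1" by (rule mult_right_less_imp_less) simp
  then have "n = 0" by linarith
  then show ?thesis using n by simp
qed

text \<open>The boundary point is \<open>0\<close>, the curve has period \<open>2 h\<close> and passes through \<open>0\<close> at time \<open>0\<close> with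
  velocity \<open>1\<close>; its curvature there is \<open>Im b\<close>.\<close>

locale normalized_boundary =
  fixes D D' :: "real \<Rightarrow> complex" and b :: complex and h \<delta> \<eta> :: real and E :: "complex set"
  assumes deriv: "\<And>t. (D has_vector_derivative D' t) (at t)"
    and cont_D': "continuous_on UNIV D'"
    and zero: "D 0 = 0"
    and unit: "D' 0 = 1"
    and second: "(D' has_vector_derivative b) (at 0)"
    and \<delta>: "0 < \<delta>" "\<delta> \<le> h"
    and near: "\<And>t. \<bar>t\<bar> \<le> \<delta> \<Longrightarrow> cmod (D' t - 1) \<le> 1 / 10"
    and \<eta>_pos: "0 < \<eta>"
    and far: "\<And>t. \<lbrakk>\<delta> \<le> \<bar>t\<bar>; \<bar>t\<bar> \<le> h\<rbrakk> \<Longrightarrow> \<eta> \<le> cmod (D t)"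
    and closed_E: "closed E"
    and frontier_E: "frontier E = D ` {-h..h}"
    and wind: "\<And>w. w \<notin> D ` {-h..h} \<Longrightarrow>
      ((\<lambda>t. D' t / (D t - w)) has_integral (if w \<in> E then 2 * of_real pi * \<i> else 0)) {-h..h}"
begin

sublocale R: unit_germ D D' b \<delta>
  by unfold_locales (use deriv zero unit second \<delta> near in auto)

text \<open>Reversing time gives velocity -1 at 0, and the half turn restores 1. The second
  derivative of \<open>- D (- t)\<close> at 0 is \<open>- b\<close>, so the backward branch bends
  the opposite way.\<close>

sublocale L: unit_germ "\<lambda>t. - D (- t)" "\<lambda>t. D' (- t)" "- b" \<delta>
proof unfold_locales
  show "((\<lambda>t. - D (- t)) has_vector_derivative D' (- t)) (at t)" for t
  proof -
    have "((D \<circ> uminus) has_vector_derivative (-1) *\<^sub>R D' (- t)) (at t)"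
      using deriv[of "- t"] by (intro vector_diff_chain_at) (auto intro!: derivative_eq_intros)
    then show ?thesis using has_vector_derivative_minus by (fastforce simp: o_def)
  qed
  have "((D' \<circ> uminus) has_vector_derivative (-1) *\<^sub>R b) (at 0)"
    using second by (intro vector_diff_chain_at) (auto intro!: derivative_eq_intros)
  then show "((\<lambda>t. D' (- t)) has_vector_derivative - b) (at 0)" by (simp add: o_def)
qed (use zero unit \<delta> near in auto)

text \<open>A smaller circle misses all of the curve with
  \<open>\<delta> \<le> \<bar>t\<bar>\<close> and is reached by both branches.\<close>

definition \<rho>\<^sub>0 :: real where "\<rho>\<^sub>0 = Min {\<eta>, R.radius, L.radius}"

lemma \<rho>\<^sub>0: "0 < \<rho>\<^sub>0" "\<rho>\<^sub>0 \<le> \<eta>" "\<rho>\<^sub>0 \<le> R.radius" "\<rho>\<^sub>0 \<le> L.radius"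
  using \<eta>_pos R.radius_pos L.radius_pos by (auto simp: \<rho>\<^sub>0_def)

abbreviation \<alpha> :: "real \<Rightarrow> real" where "\<alpha> \<equiv> R.angle"

text \<open>Adding \<open>pi\<close> undoes the half turn in \<open>L\<close>.\<close>

definition \<beta> :: "real \<Rightarrow> real" where "\<beta> \<rho> = pi + L.angle \<rho>"

lemma angle_bounds:
  assumes "\<rho> \<in> {0<..<\<rho>\<^sub>0}"
  shows "- pi / 4 < \<alpha> \<rho>" "\<alpha> \<rho> < pi / 4" "3 * pi / 4 < \<beta> \<rho>" "\<beta> \<rho> < 5 * pi / 4"
  using R.abs_angle[of \<rho>] L.abs_angle[of \<rho>] assms \<rho>\<^sub>0 by (auto simp: \<beta>_def abs_less_iff)

text \<open>By \<open>far\<close> a crossing happens at a time below \<delta> in absolute value, and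
  on each branch the modulus is injective, so \<open>hit\<close> gives the only candidate.\<close>

lemma circle_meets_curve:
  assumes \<rho>: "\<rho> \<in> {0<..<\<rho>\<^sub>0}" and z: "cmod z = \<rho>"
  shows "z \<in> D ` {-h..h} \<longleftrightarrow> z = of_real \<rho> * cis (\<alpha> \<rho>) \<or> z = of_real \<rho> * cis (\<beta> \<rho>)"
proof
  have \<rho>': "\<rho> \<in> {0<..R.radius}" "\<rho> \<in> {0<..L.radius}" "\<rho> < \<eta>" using \<rho> \<rho>\<^sub>0 by auto
  have right: "D (R.hit \<rho>) = of_real \<rho> * cis (\<alpha> \<rho>)" using R.d_hit \<rho>' by blast
  have left: "D (- L.hit \<rho>) = of_real \<rho> * cis (\<beta> \<rho>)"
    using L.d_hit[OF \<rho>'(2)] by (simp add: \<beta>_def minus_equation_iff[of "D _"] flip: cis_mult)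
  {
    assume "z \<in> D ` {-h..h}"
    then obtain t where "t \<in> {-h..h}" "z = D t" by blast
    then have t: "\<bar>t\<bar> \<le> h" "z = D t" by auto
    then have "\<bar>t\<bar> < \<delta>" using far[of t] z \<rho>' by force
    then have "t = R.hit \<rho> \<or> t = - L.hit \<rho>"
      using R.hit_norm[of t] L.hit_norm[of "- t"] t z by (cases "0 \<le> t") auto
    then show "z = of_real \<rho> * cis (\<alpha> \<rho>) \<or> z = of_real \<rho> * cis (\<beta> \<rho>)"
      using t left right by auto
  }
  have "R.hit \<rho> \<in> {-h..h}" "- L.hit \<rho> \<in> {-h..h}"
    using R.hit_in[of \<rho>] L.hit_in[of \<rho>] \<rho>' \<delta> by auto
  then show "z \<in> D ` {-h..h}" if "z = of_real \<rho> * cis (\<alpha> \<rho>) \<or> z = of_real \<rho> * cis (\<beta> \<rho>)"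
    using that left right by (metis image_eqI)
qed

lemma off_curve:
  assumes \<rho>: "\<rho> \<in> {0<..<\<rho>\<^sub>0}" and x: "x \<in> {\<alpha> \<rho><..<\<beta> \<rho>} \<union> {\<beta> \<rho><..<\<alpha> \<rho> + 2 * pi}"
  shows "of_real \<rho> * cis x \<notin> D ` {-h..h}"
proof
  assume "of_real \<rho> * cis x \<in> D ` {-h..h}"
  then have "cis x = cis (\<alpha> \<rho>) \<or> cis x = cis (\<beta> \<rho>)"
    using circle_meets_curve[OF \<rho>, of "of_real \<rho> * cis x"] \<rho> by (simp add: norm_mult)
  moreover have "\<bar>x - \<alpha> \<rho>\<bar> < 2 * pi" "\<bar>x - \<beta> \<rho>\<bar> < 2 * pi"
    using x angle_bounds[OF \<rho>] by auto
  ultimately have "x = \<alpha> \<rho> \<or> x = \<beta> \<rho>" using cis_eq_imp_eq by blast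
  then show False using x angle_bounds[OF \<rho>] by auto
qed

text \<open>The denominator is \<open>P + x\<close> with
  \<open>P = t\<^sup>2 + \<epsilon>\<^sup>2\<close>. Factoring \<open>x\<close> as (D t - t)(D t +
  t) gives \<open>cmod x \<le> 21/100 * P\<close>. Multiplying by the conjugate denominator leaves a
  real part of at least (1 - 1/10 - 11/10 * 21/100) P, more than P / 2, over at most (121/100 P)^2;
  the quotient exceeds 1 / (4 P).\<close>

lemma integrand_near:
  assumes t: "\<bar>t\<bar> \<le> \<delta>" and \<epsilon>: "0 < \<epsilon>"
  shows "1 / (4 * (t\<^sup>2 + \<epsilon>\<^sup>2)) \<le> Re (D' t / ((D t)\<^sup>2 + of_real (\<epsilon>\<^sup>2)))"
proof -
  define P where "P = t\<^sup>2 + \<epsilon>\<^sup>2"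
  define x where "x = (D t)\<^sup>2 - of_real (t\<^sup>2)"
  define e where "e = D' t - 1"
  have P: "0 < P" using \<epsilon> by (simp add: P_def add_nonneg_pos)
  have e: "cmod e \<le> 1 / 10" using near[OF t] by (simp add: e_def)
  have x: "cmod x \<le> 21 / 100 * P"
  proof -
    have n: "cmod (D t - of_real t) \<le> \<bar>t\<bar> / 10" by (rule R.near_line[OF t])
    have "cmod (D t + of_real t) \<le> cmod (D t - of_real t) + cmod (2 * of_real t)"
      using norm_triangle_ineq[of "D t - of_real t" "2 * of_real t"] by (simp add: add.commute)
    then have p: "cmod (D t + of_real t) \<le> 21 / 10 * \<bar>t\<bar>" using n by (simp add: norm_mult)
    have "x = (D t - of_real t) * (D t + of_real t)" by (simp add: x_def algebra_simps power2_eq_square)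
    then have "cmod x = cmod (D t - of_real t) * cmod (D t + of_real t)" by (simp only: norm_mult)
    also have "\<dots> \<le> (\<bar>t\<bar> / 10) * (21 / 10 * \<bar>t\<bar>)"
      using n p by (intro mult_mono) auto
    also have "\<dots> = 21 / 100 * t\<^sup>2" by (simp add: power2_eq_square)
    also have "\<dots> \<le> 21 / 100 * P" by (simp add: P_def)
    finally show ?thesis .
  qed
  have N: "(D t)\<^sup>2 + of_real (\<epsilon>\<^sup>2) = of_real P + x" by (simp add: x_def P_def)
  have D': "D' t = 1 + e" by (simp add: e_def)
  have "cmod (of_real P + x) \<le> P + 21 / 100 * P"
    using norm_triangle_ineq[of "of_real P" x] x P by simp
  then have up: "(cmod (of_real P + x))\<^sup>2 \<le> (121 / 100 * P)\<^sup>2"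
    by (intro power_mono) auto
  have "P - 21 / 100 * P \<le> cmod (of_real P + x)"
    using norm_diff_ineq[of "of_real P" x] x P by simp
  then have pos: "0 < (cmod (of_real P + x))\<^sup>2" using P by auto
  have "cmod (e * of_real P + (1 + e) * cnj x) \<le> 1 / 10 * P + 11 / 10 * (21 / 100 * P)"
  proof (rule order_trans[OF norm_triangle_ineq add_mono])
    show "cmod (e * of_real P) \<le> 1 / 10 * P" using e P by (simp add: norm_mult)
    have "cmod (1 + e) \<le> 11 / 10" using norm_triangle_ineq[of 1 e] e by simp
    then show "cmod ((1 + e) * cnj x) \<le> 11 / 10 * (21 / 100 * P)"
      unfolding norm_mult using x by (intro mult_mono) auto
  qed
  then have "- (1 / 10 * P + 11 / 10 * (21 / 100 * P)) \<le> Re (e * of_real P + (1 + e) * cnj x)"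
    using abs_Re_le_cmod[of "e * of_real P + (1 + e) * cnj x"] by linarith
  moreover have "(1 + e) * cnj (of_real P + x) = of_real P + (e * of_real P + (1 + e) * cnj x)"
    by (simp add: algebra_simps)
  ultimately have lo: "1 / 2 * P \<le> Re ((1 + e) * cnj (of_real P + x))"
    using P by simp
  have "1 / (4 * P) \<le> (1 / 2 * P) / (121 / 100 * P)\<^sup>2"
    using P by (simp add: field_simps power2_eq_square)
  also have "\<dots> \<le> Re ((1 + e) * cnj (of_real P + x)) / (cmod (of_real P + x))\<^sup>2"
    using lo up pos P by (intro frac_le) auto
  also have "\<dots> = Re ((1 + e) / (of_real P + x))"
    by (simp add: complex_div_cnj[of "1 + e"])
  finally show ?thesis by (simp only: N D' P_def)
qed

text \<open>Near time \<open>0\<close> the integrand of the difference of the winding numbers about \<open>\<i>\<epsilon>\<close> and \<open>- \<i>\<epsilon>\<close>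
  behaves like the Poisson kernel \<open>\<epsilon> / (t\<^sup>2 + \<epsilon>\<^sup>2)\<close>, and elsewhere it is \<open>O(\<epsilon>)\<close>.\<close>

lemma axis_membership:
  obtains \<epsilon>\<^sub>0 where "0 < \<epsilon>\<^sub>0"
    "\<And>\<epsilon>. \<epsilon> \<in> {0<..<\<epsilon>\<^sub>0} \<Longrightarrow> of_real \<epsilon> * \<i> \<in> E \<and> - (of_real \<epsilon> * \<i>) \<notin> E"
proof -
  obtain M where M: "\<And>t. t \<in> {-h..h} \<Longrightarrow> cmod (D' t) \<le> M" "0 < M"
  proof -
    have "bounded (D' ` {-h..h})"
      by (intro compact_imp_bounded compact_continuous_image continuous_on_subset[OF cont_D']) auto
    then show ?thesis using that unfolding bounded_pos by blast
  qed
  have h: "0 < h" using \<delta> by simp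
  \<comment> \<open>\<delta> puts \<open>{-\<epsilon>..\<epsilon>}\<close> inside the range of
    \<open>integrand_near\<close>; \<open>\<rho>\<^sub>0\<close> keeps the two axis points off the
    curve; \<open>\<eta> / 2\<close> keeps the denominator away from 0 on the far part; the last
    entry makes the error \<open>2 * h * K\<close> smaller than 1/4.\<close>
  define \<epsilon>\<^sub>0 where "\<epsilon>\<^sub>0 = Min {\<delta>, \<rho>\<^sub>0, \<eta> / 2, \<eta>\<^sup>2 / (16 * h * M)}"
  have \<epsilon>\<^sub>0: "0 < \<epsilon>\<^sub>0" "\<epsilon>\<^sub>0 \<le> \<delta>" "\<epsilon>\<^sub>0 \<le> \<rho>\<^sub>0" "\<epsilon>\<^sub>0 \<le> \<eta> / 2" "\<epsilon>\<^sub>0 \<le> \<eta>\<^sup>2 / (16 * h * M)"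
    using \<delta> \<rho>\<^sub>0 \<eta>_pos h M(2) unfolding \<epsilon>\<^sub>0_def by (auto intro!: Min.coboundedI)
  show ?thesis
  proof (rule that[OF \<epsilon>\<^sub>0(1)])
    fix \<epsilon> assume e: "\<epsilon> \<in> {0<..<\<epsilon>\<^sub>0}"
    let ?w = "of_real \<epsilon> * \<i>"
    have \<epsilon>: "0 < \<epsilon>" "\<epsilon> < \<delta>" "\<epsilon> \<in> {0<..<\<rho>\<^sub>0}" "\<epsilon> < \<eta> / 2" "\<epsilon> < \<eta>\<^sup>2 / (16 * h * M)"
      using e \<epsilon>\<^sub>0 by auto
    have off': "?w \<notin> D ` {-h..h}" "- ?w \<notin> D ` {-h..h}"
      using angle_bounds[OF \<epsilon>(3)] off_curve[OF \<epsilon>(3), of "pi / 2"] off_curve[OF \<epsilon>(3), of "3 * pi / 2"]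
      by (simp_all add: cis_3_pi_half)
    define f where "f t = Re (of_real \<epsilon> * (D' t / ((D t)\<^sup>2 + of_real (\<epsilon>\<^sup>2))))" for t
    define J where "J = (if ?w \<in> E then 2 * of_real pi * \<i> else 0) - (if - ?w \<in> E then 2 * of_real pi * \<i> else 0)"
    have "((\<lambda>t. Im (D' t / (D t - ?w) - D' t / (D t - (- ?w)))) has_integral Im J) {-h..h}"
      unfolding J_def by (intro has_integral_Im has_integral_diff wind off')
    \<comment> \<open>Partial fractions: the two poles combine to the factor
      \<open>2 * \<i> * \<epsilon>\<close> over
      \<open>(D t)\<^sup>2 + \<epsilon>\<^sup>2\<close>.\<close>
    moreover have "Im (D' t / (D t - ?w) - D' t / (D t - (- ?w))) = 2 * f t" if "t \<in> {-h..h}" for t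
    proof -
      have "D t \<noteq> ?w" "D t \<noteq> - ?w" using off' imageI[OF that, of D] by metis+
      then have nz: "D t - ?w \<noteq> 0" "D t - (- ?w) \<noteq> 0" by (auto simp: eq_neg_iff_add_eq_0)
      have "(D t)\<^sup>2 + of_real (\<epsilon>\<^sup>2) = (D t - ?w) * (D t - (- ?w))"
        by (simp add: algebra_simps power2_eq_square)
      then have "D' t / (D t - ?w) - D' t / (D t - (- ?w)) = 2 * \<i> * (of_real \<epsilon> * (D' t / ((D t)\<^sup>2 + of_real (\<epsilon>\<^sup>2))))"
        using nz by (simp add: diff_frac_eq) (simp add: field_simps)
      moreover have "Im (2 * \<i> * z) = 2 * Re z" for z by simp
      ultimately show ?thesis by (simp only: f_def)
    qed
    ultimately have "((\<lambda>t. 2 * f t) has_integral Im J) {-h..h}"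
      using has_integral_cong by (metis (no_types, lifting))
    then have int_f: "(f has_integral Im J / 2) {-h..h}"
      using has_integral_mult_right[of "\<lambda>t. 2 * f t" "Im J" "{-h..h}" "1/2"] by simp
    define K where "K = 2 * \<epsilon> * M / \<eta>\<^sup>2"
    have K: "0 \<le> K" "2 * h * K < 1 / 4"
      using \<epsilon> M(2) \<eta>_pos h by (auto simp: K_def field_simps)
    \<comment> \<open>A step function below \<open>f\<close>: for
      \<open>\<bar>t\<bar> \<le> \<epsilon>\<close> the lower bound of
      \<open>integrand_near\<close>, times \<epsilon>, is at least
      \<open>1 / (8 * \<epsilon>)\<close>, which contributes 1/4 to the integral, and
      \<open>- K\<close> absorbs the far part.\<close>
    define g where "g t = - K + (if t \<in> {-\<epsilon>..\<epsilon>} then 1 / (8 * \<epsilon>) else 0)" for t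
    have "((\<lambda>t. if t \<in> {-\<epsilon>..\<epsilon>} then 1 / (8 * \<epsilon>) else 0) has_integral (1 / 4)) {-h..h}"
    proof -
      have "((\<lambda>t. 1 / (8 * \<epsilon>)) has_integral (1 / 4)) {-\<epsilon>..\<epsilon>}"
        using has_integral_const_real[of "1 / (8 * \<epsilon>)" "- \<epsilon>" \<epsilon>] \<epsilon> by simp
      then show ?thesis using \<epsilon> \<delta> by (subst has_integral_restrict) auto
    qed
    moreover have "((\<lambda>t. - K) has_integral (- (2 * h * K))) {-h..h}"
      using has_integral_const_real[of "- K" "- h" h] h by simp
    ultimately have int_g: "(g has_integral (- (2 * h * K) + 1 / 4)) {-h..h}"
      unfolding g_def by (intro has_integral_add)
    have "g t \<le> f t" if t: "t \<in> {-h..h}" for t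
    proof (cases "\<bar>t\<bar> \<le> \<delta>")
      case True
      have f: "\<epsilon> * (1 / (4 * (t\<^sup>2 + \<epsilon>\<^sup>2))) \<le> f t"
      proof -
        have "f t = \<epsilon> * Re (D' t / ((D t)\<^sup>2 + of_real (\<epsilon>\<^sup>2)))"
          unfolding f_def by (simp only: Re_complex_of_real Im_complex_of_real times_complex.sel mult_zero_left diff_0_right)
        then show ?thesis using integrand_near[OF True \<epsilon>(1)] \<epsilon>(1) by (simp only:) (intro mult_left_mono; simp)
      qed
      have p: "0 < t\<^sup>2 + \<epsilon>\<^sup>2" using \<epsilon> by (simp add: add_nonneg_pos)
      show ?thesis
      proof (cases "t \<in> {-\<epsilon>..\<epsilon>}")
        case True
        then have "t\<^sup>2 \<le> \<epsilon>\<^sup>2" by (simp add: abs_le_square_iff[symmetric] abs_le_iff)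
        then have "1 / (8 * \<epsilon>) \<le> \<epsilon> * (1 / (4 * (t\<^sup>2 + \<epsilon>\<^sup>2)))"
          using \<epsilon>(1) p by (simp add: field_simps power2_eq_square)
        moreover have "g t = - K + 1 / (8 * \<epsilon>)" using True unfolding g_def by (simp only: if_True)
        ultimately show ?thesis using f K by linarith
      next
        case False
        have "0 \<le> \<epsilon> * (1 / (4 * (t\<^sup>2 + \<epsilon>\<^sup>2)))" using \<epsilon> p by simp
        moreover have "g t = - K" using False unfolding g_def by (simp only: if_False add_0_right)
        ultimately show ?thesis using f K by linarith
      qed
    next
      case False
      have "\<eta> \<le> cmod (D t)" using far[of t] False t by auto
      then have "\<eta>\<^sup>2 \<le> (cmod (D t))\<^sup>2" using \<eta>_pos by (intro power_mono) auto
      moreover have "\<epsilon>\<^sup>2 \<le> (\<eta> / 2)\<^sup>2" using \<epsilon> by (intro power_mono) auto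
      moreover have "(cmod (D t))\<^sup>2 - \<epsilon>\<^sup>2 \<le> cmod ((D t)\<^sup>2 + of_real (\<epsilon>\<^sup>2))"
        using norm_diff_ineq[of "(D t)\<^sup>2" "of_real (\<epsilon>\<^sup>2)"] by (simp add: norm_power)
      moreover have "0 < \<eta>\<^sup>2" using \<eta>_pos by simp
      moreover have "(\<eta> / 2)\<^sup>2 = \<eta>\<^sup>2 / 4" by (simp add: power_divide)
      ultimately have N: "\<eta>\<^sup>2 / 2 \<le> cmod ((D t)\<^sup>2 + of_real (\<epsilon>\<^sup>2))"
        by linarith
      have "\<bar>f t\<bar> \<le> cmod (of_real \<epsilon> * (D' t / ((D t)\<^sup>2 + of_real (\<epsilon>\<^sup>2))))"
        unfolding f_def by (rule abs_Re_le_cmod)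
      also have "\<dots> = \<epsilon> * (cmod (D' t) / cmod ((D t)\<^sup>2 + of_real (\<epsilon>\<^sup>2)))"
        using \<epsilon> by (simp add: norm_mult norm_divide)
      also have "\<dots> \<le> \<epsilon> * (M / (\<eta>\<^sup>2 / 2))"
        using N M t \<epsilon> \<eta>_pos by (intro mult_left_mono frac_le) auto
      also have "\<dots> = K" by (simp add: K_def field_simps)
      finally have "\<bar>f t\<bar> \<le> K" .
      moreover have "t \<notin> {-\<epsilon>..\<epsilon>}" using False \<epsilon> by auto
      then have "g t = - K" unfolding g_def by (simp only: if_False add_0_right)
      ultimately show ?thesis by linarith
    qed
    then have "- (2 * h * K) + 1 / 4 \<le> Im J / 2"
      by (rule has_integral_le[OF int_g int_f])
    \<comment> \<open>\<open>Im J\<close> can only be 0 or plus or minus \<open>2 * pi\<close>;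
      positivity singles out \<open>?w\<close> inside and \<open>- ?w\<close> outside.\<close>
    then have "0 < Im J" using K by linarith
    then show "?w \<in> E \<and> - ?w \<notin> E" by (auto simp: J_def split: if_splits)
  qed
qed

text \<open>The two crossings cut the circle into two open arcs that avoid the frontier, so each is
  wholly inside or wholly outside \<open>E\<close>. Their points at angles \<open>pi / 2\<close> and
  \<open>3 * pi / 2\<close> decide which, by \<open>axis_membership\<close>; the crossings
  themselves belong to \<open>E\<close> because it is closed.\<close>

lemma circle_in_region:
  obtains R where "0 < R" "R \<le> \<rho>\<^sub>0"
    "\<And>\<rho> \<phi>. \<lbrakk>\<rho> \<in> {0<..<R}; \<alpha> \<rho> \<le> \<phi>; \<phi> < \<alpha> \<rho> + 2 * pi\<rbrakk> \<Longrightarrow>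
      of_real \<rho> * cis \<phi> \<in> E \<longleftrightarrow> \<phi> \<le> \<beta> \<rho>"
proof -
  obtain \<epsilon>\<^sub>0 where \<epsilon>\<^sub>0: "0 < \<epsilon>\<^sub>0"
    "\<And>\<epsilon>. \<epsilon> \<in> {0<..<\<epsilon>\<^sub>0} \<Longrightarrow> of_real \<epsilon> * \<i> \<in> E \<and> - (of_real \<epsilon> * \<i>) \<notin> E"
    using axis_membership by blast
  show ?thesis
  proof (rule that[of "min \<epsilon>\<^sub>0 \<rho>\<^sub>0"])
    fix \<rho> \<phi> assume \<rho>: "\<rho> \<in> {0<..<min \<epsilon>\<^sub>0 \<rho>\<^sub>0}" and \<phi>: "\<alpha> \<rho> \<le> \<phi>" "\<phi> < \<alpha> \<rho> + 2 * pi"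
    then have \<rho>': "\<rho> \<in> {0<..<\<rho>\<^sub>0}" "0 < \<rho>" by auto
    note ab = angle_bounds[OF \<rho>'(1)]
    have axis: "of_real \<rho> * cis (pi / 2) \<in> E" "of_real \<rho> * cis (3 * pi / 2) \<notin> E"
    proof -
      have "of_real \<rho> * \<i> = of_real \<rho> * cis (pi / 2)" "- (of_real \<rho> * \<i>) = of_real \<rho> * cis (3 * pi / 2)"
        by (simp_all add: cis_3_pi_half)
      then show "of_real \<rho> * cis (pi / 2) \<in> E" "of_real \<rho> * cis (3 * pi / 2) \<notin> E"
        using \<epsilon>\<^sub>0(2)[of \<rho>] \<rho> by auto
    qed
    have arc: "connected ((\<lambda>x. of_real \<rho> * cis x) ` S)" if "connected S" for S
      using that by (intro connected_continuous_image continuous_intros)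
    have off: "of_real \<rho> * cis x \<notin> frontier E"
      if "x \<in> {\<alpha> \<rho><..<\<beta> \<rho>} \<union> {\<beta> \<rho><..<\<alpha> \<rho> + 2 * pi}" for x
      using off_curve[OF \<rho>'(1) that] by (simp add: frontier_E)
    consider "\<phi> = \<alpha> \<rho> \<or> \<phi> = \<beta> \<rho>" | "\<phi> \<in> {\<alpha> \<rho><..<\<beta> \<rho>}" | "\<phi> \<in> {\<beta> \<rho><..<\<alpha> \<rho> + 2 * pi}"
      using \<phi> by fastforce
    then show "of_real \<rho> * cis \<phi> \<in> E \<longleftrightarrow> \<phi> \<le> \<beta> \<rho>"
    proof cases
      case 1
      then have "of_real \<rho> * cis \<phi> \<in> frontier E"
        using circle_meets_curve[OF \<rho>'(1), of "of_real \<rho> * cis \<phi>"] \<rho>'(2) by (auto simp: norm_mult frontier_E)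
      then show ?thesis using 1 closed_E frontier_subset_closed ab by auto
    next
      case 2
      let ?U = "(\<lambda>x. of_real \<rho> * cis x) ` {\<alpha> \<rho><..<\<beta> \<rho>}"
      have "?U \<inter> frontier E = {}" using off by blast
      moreover have "pi / 2 \<in> {\<alpha> \<rho><..<\<beta> \<rho>}" using ab by simp
      then have "?U \<inter> E \<noteq> {}" using axis(1) by blast
      moreover have "connected ?U" by (rule arc) simp
      ultimately have "?U - E = {}" using connected_Int_frontier[of ?U E] by metis
      moreover have "of_real \<rho> * cis \<phi> \<in> ?U" using 2 by (rule imageI)
      ultimately show ?thesis using 2 by auto
    next
      case 3
      let ?U = "(\<lambda>x. of_real \<rho> * cis x) ` {\<beta> \<rho><..<\<alpha> \<rho> + 2 * pi}"
      have "?U \<inter> frontier E = {}" using off by blast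
      moreover have "3 * pi / 2 \<in> {\<beta> \<rho><..<\<alpha> \<rho> + 2 * pi}" using ab by simp
      then have "?U - E \<noteq> {}" using axis(2) by blast
      moreover have "connected ?U" by (rule arc) simp
      ultimately have "?U \<inter> E = {}" using connected_Int_frontier[of ?U E] by metis
      moreover have "of_real \<rho> * cis \<phi> \<in> ?U" using 3 by (rule imageI)
      ultimately show ?thesis using 3 by auto
    qed
  qed (use \<epsilon>\<^sub>0 \<rho>\<^sub>0 in auto)
qed

lemma density_limit:
  "right_slope_limit (\<lambda>\<rho>. measure lborel (E \<inter> cball 0 \<rho>) / (pi * \<rho>\<^sup>2)) (- Im b / (3 * pi))"
proof -
  obtain R where R: "0 < R" "R \<le> \<rho>\<^sub>0" and mem: "\<And>\<rho> \<phi>. \<lbrakk>\<rho> \<in> {0<..<R}; \<alpha> \<rho> \<le> \<phi>; \<phi> < \<alpha> \<rho> + 2 * pi\<rbrakk> \<Longrightarrow>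
      of_real \<rho> * cis \<phi> \<in> E \<longleftrightarrow> \<phi> \<le> \<beta> \<rho>"
    using circle_in_region by blast
  let ?A = "\<lambda>r. measure lborel (E \<inter> cball 0 r)"
  have A': "(?A has_real_derivative r * (\<beta> r - \<alpha> r)) (at r)" if "r \<in> {0<..<R}" for r
  proof (rule measure_disk_derivative[OF _ _ _ _ mem that])
    show "E \<in> sets borel" using closed_E by simp
    have sub: "{0<..<R} \<subseteq> {0<..<R.radius}" "{0<..<R} \<subseteq> {0<..<L.radius}" using R \<rho>\<^sub>0 by auto
    show "continuous_on {0<..<R} \<alpha>" by (rule continuous_on_subset[OF R.continuous_angle sub(1)])
    show "continuous_on {0<..<R} \<beta>"
      unfolding \<beta>_def by (intro continuous_intros continuous_on_subset[OF L.continuous_angle sub(2)])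
    show "\<alpha> \<rho> < \<beta> \<rho> \<and> \<beta> \<rho> < \<alpha> \<rho> + 2 * pi" if "\<rho> \<in> {0<..<R}" for \<rho>
      using angle_bounds[of \<rho>] that R by auto
  qed
  have A0: "(?A \<longlongrightarrow> 0) (at_right 0)"
  proof (rule tendsto_sandwich[of "\<lambda>_. 0"])
    have "?A r \<le> pi * r\<^sup>2" if "0 < r" for r
    proof -
      have "?A r \<le> measure lborel (cball (0::complex) r)"
        using closed_E emeasure_bounded_finite[of "cball (0::complex) r"]
        by (intro measure_mono_fmeasurable fmeasurableI) auto
      then show ?thesis using that by (simp add: content_cball unit_ball_vol_2)
    qed
    then show "\<forall>\<^sub>F r in at_right 0. ?A r \<le> pi * r\<^sup>2" by (simp add: eventually_at_filter)
    show "((\<lambda>r. pi * r\<^sup>2) \<longlongrightarrow> 0) (at_right (0::real))" by real_asymp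
  qed simp_all
  \<comment> \<open>Each branch contributes \<open>- Im b / 2\<close>: the forward one because
    \<alpha> is subtracted, the backward one because its germ has \<open>- b\<close>.\<close>
  have "((\<lambda>r. L.angle r / r - \<alpha> r / r) \<longlongrightarrow> Im (- b) / 2 - Im b / 2) (at_right 0)"
    by (intro tendsto_diff L.tendsto_angle R.tendsto_angle)
  then have \<theta>: "((\<lambda>r. ((\<beta> r - \<alpha> r) - pi) / r) \<longlongrightarrow> - Im b) (at_right 0)"
    by (simp add: \<beta>_def diff_divide_distrib)
  show ?thesis by (rule density_derivative[OF R(1) A' A0 \<theta>])
qed

end

section \<open>Closed parameterizations and winding numbers\<close>

lemma has_vector_derivative_affine:
  assumes "(f has_vector_derivative f') (at (a + m * t))"
  shows "((\<lambda>t. f (a + m * t)) has_vector_derivative m *\<^sub>R f') (at t)"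
proof -
  have "((\<lambda>t. a + m * t) has_real_derivative m) (at t)" by (auto intro!: derivative_eq_intros)
  then have "((\<lambda>t. a + m * t) has_vector_derivative m) (at t)"
    by (simp add: has_real_derivative_iff_has_vector_derivative)
  from vector_diff_chain_at[OF this assms] show ?thesis by (simp add: o_def)
qed

lemma subtract_period:
  fixes x a T :: real
  assumes "0 < T"
  shows "x - of_int \<lfloor>(x - a) / T\<rfloor> * T \<in> {a..<a + T}"
proof -
  define n where "n = \<lfloor>(x - a) / T\<rfloor>"
  have "of_int n \<le> (x - a) / T" "(x - a) / T < of_int n + 1" by (simp_all add: n_def)
  then show ?thesis using assms unfolding n_def[symmetric] by (auto simp: field_simps)
qed

text \<open>Cut \<open>{0..T}\<close> at the remainder \<open>r\<close> of \<open>s\<close> modulo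
  \<open>T\<close>, move the first piece one period to the right, then translate by a whole number
  of periods.\<close>

lemma has_integral_periodic:
  fixes f :: "real \<Rightarrow> complex"
  assumes f: "(f has_integral I) {0..T}" and per: "\<And>x. f (x + T) = f x" and T: "0 < T"
  shows "(f has_integral I) {s..s + T}"
proof -
  interpret periodic_fun_simple f T by unfold_locales (rule per)
  define n where "n = \<lfloor>s / T\<rfloor>"
  define r where "r = s - of_int n * T"
  have r: "0 \<le> r" "r < T" using subtract_period[OF T, of s 0] by (auto simp: r_def n_def)
  have shift: "((\<lambda>x. f (x + c)) has_integral J) {a - c..b - c}" if "(f has_integral J) {a..b}" for a b c J
    using has_integral_affinity'[of f J a b 1 c] that by simp
  have "f integrable_on {0..r}" "f integrable_on {r..T}"
    using f r by (auto intro: integrable_subinterval_real simp: has_integral_integrable)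
  then obtain J K where J: "(f has_integral J) {0..r}" and K: "(f has_integral K) {r..T}"
    by (auto simp: integrable_on_def)
  have IJK: "I = J + K"
    using has_integral_combine[OF r(1) less_imp_le[OF r(2)] J K] f has_integral_unique by blast
  have "((\<lambda>x. f (x + (- T))) has_integral J) {0 - (- T)..r - (- T)}" by (rule shift[OF J])
  moreover have "f (x + (- T)) = f x" for x using per[of "x - T"] by simp
  ultimately have "(f has_integral J) {T..r + T}" by simp
  then have "(f has_integral K + J) {r..r + T}"
    using r by (intro has_integral_combine[OF _ _ K]) auto
  then have "((\<lambda>x. f (x + (- (of_int n * T)))) has_integral K + J) {r - (- (of_int n * T))..r + T - (- (of_int n * T))}"
    by (rule shift)
  moreover have "f (x + (- (of_int n * T))) = f x" for x using plus_of_int[of "x - of_int n * T" n] by simp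
  ultimately show ?thesis by (simp add: r_def IJK add.commute)
qed

lemma simple_closed_param_path:
  assumes "simple_closed_param C T c"
  defines "g \<equiv> \<lambda>t. c (T * t)"
  shows "simple_path g" "pathfinish g = pathstart g" "path_image g = C"
proof -
  have T: "0 < T" and cont: "continuous_on UNIV c" and per: "\<And>t. c (t + T) = c t"
    and inj: "inj_on c {0..<T}" and im: "c ` {0..<T} = C"
    using assms(1) by (auto simp: simple_closed_param_def)
  have cT: "c T = c 0" using per[of 0] by simp
  show "pathfinish g = pathstart g" by (simp add: g_def pathfinish_def pathstart_def cT)
  have inj': "x = y" if "c x = c y" "x \<in> {0..<T}" "y \<in> {0..<T}" for x y
    using inj that by (auto simp: inj_on_def)
  show "simple_path g"
    unfolding simple_path_def loop_free_def path_def
  proof (intro conjI ballI impI)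
    show "continuous_on {0..1} g"
      unfolding g_def by (intro continuous_on_compose2[OF cont] continuous_intros) auto
    fix x y :: real assume xy: "x \<in> {0..1}" "y \<in> {0..1}" "g x = g y"
    have lt: "T * z < T" if "z \<in> {0..1}" "z \<noteq> 1" for z using that T by auto
    consider "x = 1" "y = 1" | "x = 1" "y \<noteq> 1" | "x \<noteq> 1" "y = 1" | "x \<noteq> 1" "y \<noteq> 1" by blast
    then show "x = y \<or> x = 0 \<and> y = 1 \<or> x = 1 \<and> y = 0"
    proof cases
      case 2
      then have "0 = T * y" using xy T lt[of y] cT by (intro inj') (auto simp: g_def)
      then show ?thesis using 2 T by simp
    next
      case 3
      then have "T * x = 0" using xy T lt[of x] cT by (intro inj') (auto simp: g_def)
      then show ?thesis using 3 T by simp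
    next
      case 4
      then have "T * x = T * y" using xy T lt[of x] lt[of y] by (intro inj') (auto simp: g_def)
      then show ?thesis using T by simp
    qed simp
  qed
  show "path_image g = C"
  proof
    show "path_image g \<subseteq> C"
    proof
      fix z assume "z \<in> path_image g"
      then obtain t where t: "t \<in> {0..1}" "z = c (T * t)" by (auto simp: path_image_def g_def)
      show "z \<in> C"
      proof (cases "t = 1")
        case True
        then show ?thesis using t im cT T by force
      next
        case False
        then have "T * t \<in> {0..<T}" using t T by auto
        then show ?thesis using t im by blast
      qed
    qed
    show "C \<subseteq> path_image g"
    proof
      fix z assume "z \<in> C"
      then obtain t where "t \<in> {0..<T}" "z = c t" using im by blast
      then have "t / T \<in> {0..1}" "z = g (t / T)" using T by (auto simp: g_def)
      then show "z \<in> path_image g" by (auto simp: path_image_def)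
    qed
  qed
qed

text \<open>Reduction modulo \<open>T\<close> lands in the interval of injectivity, so
  \<open>x - y\<close> is an integer multiple of \<open>T\<close>, and only 0 is small
  enough.\<close>

lemma simple_closed_param_inj:
  assumes "simple_closed_param C T c" and eq: "c x = c y" and "\<bar>x - y\<bar> < T"
  shows "x = y"
proof -
  have T: "0 < T" and per: "\<And>t. c (t + T) = c t" and inj: "inj_on c {0..<T}"
    using assms(1) by (auto simp: simple_closed_param_def)
  interpret periodic_fun_simple c T by unfold_locales (rule per)
  define r where "r x = x - of_int \<lfloor>x / T\<rfloor> * T" for x
  have r: "r x \<in> {0..<T}" "c (r x) = c x" for x
  proof -
    show "r x \<in> {0..<T}" using subtract_period[OF T, of x 0] by (simp add: r_def)
    show "c (r x) = c x" using minus_of_int[of x "\<lfloor>x / T\<rfloor>"] by (simp add: r_def)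
  qed
  have "r x = r y" using inj r eq by (metis inj_onD)
  then have d: "x - y = of_int (\<lfloor>x / T\<rfloor> - \<lfloor>y / T\<rfloor>) * T" by (simp add: r_def algebra_simps)
  define m where "m = \<lfloor>x / T\<rfloor> - \<lfloor>y / T\<rfloor>"
  have "\<bar>of_int m :: real\<bar> * T < 1 * T"
    using assms(3) T unfolding d m_def[symmetric] by (simp add: abs_mult)
  then have "\<bar>of_int m :: real\<bar> < 1" using T by (simp only: mult_less_cancel_right_pos)
  then have "m = 0" by linarith
  then show ?thesis using d by (simp add: m_def[symmetric])
qed

lemma simple_closed_param_image_period:
  assumes "simple_closed_param C T c"
  shows "c ` {s..s + T} = C" "range c = C"
proof -
  have T: "0 < T" and per: "\<And>t. c (t + T) = c t" and im: "c ` {0..<T} = C"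
    using assms(1) by (auto simp: simple_closed_param_def)
  interpret periodic_fun_simple c T by unfold_locales (rule per)
  have red: "\<exists>y\<in>{a..<a + T}. c y = c x" for a x
  proof
    define n where "n = \<lfloor>(x - a) / T\<rfloor>"
    show "x - of_int n * T \<in> {a..<a + T}" unfolding n_def by (rule subtract_period[OF T])
    show "c (x - of_int n * T) = c x" by (rule minus_of_int)
  qed
  have sub: "c x \<in> C" for x using red[of 0 x] im by (metis add_0 imageI)
  show "c ` {s..s + T} = C"
  proof
    show "C \<subseteq> c ` {s..s + T}"
    proof
      fix z assume "z \<in> C"
      then obtain x where "z = c x" using im by blast
      then obtain y where "y \<in> {s..<s + T}" "c y = z" using red[of s x] by blast
      then show "z \<in> c ` {s..s + T}" by auto
    qed
  qed (use sub in auto)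
  show "range c = C" using sub im by auto
qed

text \<open>Both Jordan components are connected and miss the frontier, so each lies in \<Omega> or
  misses it. The unbounded one cannot lie in a compact set. If the bounded one missed \<Omega> as
  well, \<Omega> would be contained in its frontier and have empty interior.\<close>

lemma C2_region_inside:
  fixes \<Omega> :: "complex set"
  assumes "compact \<Omega>" "interior \<Omega> \<noteq> {}" and g: "simple_path g" "pathfinish g = pathstart g" "path_image g = frontier \<Omega>"
    and w: "w \<notin> frontier \<Omega>"
  shows "w \<in> \<Omega> \<longleftrightarrow> w \<in> inside (frontier \<Omega>)"
proof -
  let ?C = "frontier \<Omega>"
  have J: "connected (inside ?C)" "connected (outside ?C)" "\<not> bounded (outside ?C)"
    "inside ?C \<union> outside ?C = - ?C" "inside ?C \<inter> outside ?C = {}"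
    using Jordan_inside_outside[OF g(1,2)] unfolding g(3) by auto
  have alt: "S \<subseteq> \<Omega> \<or> S \<inter> \<Omega> = {}" if "connected S" "S \<inter> ?C = {}" for S
    using connected_Int_frontier[OF that(1), of \<Omega>] that(2) by blast
  have "outside ?C \<inter> \<Omega> = {}"
    using alt[OF J(2)] J(3,4) compact_imp_bounded[OF assms(1)] bounded_subset by blast
  moreover have "inside ?C \<subseteq> \<Omega>"
  proof (rule ccontr)
    assume "\<not> inside ?C \<subseteq> \<Omega>"
    then have "inside ?C \<inter> \<Omega> = {}" using alt[OF J(1)] J(4) by blast
    with \<open>outside ?C \<inter> \<Omega> = {}\<close> J(4) have "\<Omega> \<subseteq> ?C" by blast
    then have "interior \<Omega> \<subseteq> ?C" using interior_subset by blast
    then show False using assms(2) by (auto simp: frontier_def)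
  qed
  ultimately show ?thesis using w J(4) by blast
qed

lemma C2_regular_paramE:
  assumes "C2_regular_param C T c"
  obtains c' c'' where "\<And>t. (c has_vector_derivative c' t) (at t)" "\<And>t. (c' has_vector_derivative c'' t) (at t)"
    "\<And>t. c' t \<noteq> 0" "continuous_on UNIV c'"
    "\<And>t. signed_curvature c t = Im (cnj (c' t) * c'' t) / norm (c' t) ^ 3"
proof
  define c' where "c' t = vector_derivative c (at t)" for t
  have c'_eq: "c' = (\<lambda>t. vector_derivative c (at t))" by (simp add: fun_eq_iff c'_def)
  have 1: "c C1_differentiable_on UNIV" "c' C1_differentiable_on UNIV" "\<And>t. c' t \<noteq> 0"
    using assms unfolding c'_eq by (auto simp: C2_regular_param_def)
  show "(c has_vector_derivative c' t) (at t)" for t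
    using 1(1) vector_derivative_works by (auto simp: C1_differentiable_on_eq c'_def)
  show "(c' has_vector_derivative vector_derivative c' (at t)) (at t)" for t
    using 1(2) vector_derivative_works by (auto simp: C1_differentiable_on_eq)
  show "c' t \<noteq> 0" for t by (rule 1)
  show "continuous_on UNIV c'" using 1(1) by (auto simp: C1_differentiable_on_eq c'_def)
  show "signed_curvature c t = Im (cnj (c' t) * vector_derivative c' (at t)) / norm (c' t) ^ 3" for t
    unfolding signed_curvature_def Let_def c'_eq by (rule refl)
qed

text \<open>Undoes the rescaling to \<open>[0,1]\<close>. The period may start at any
  \<open>s\<close>, so that it can later be centred at the time of the boundary point.\<close>

lemma winding_integral:
  assumes reg: "simple_closed_param C T c" and c': "\<And>t. (c has_vector_derivative c' t) (at t)" "continuous_on UNIV c'"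
    and w: "w \<notin> C"
  shows "((\<lambda>t. c' t / (c t - w)) has_integral 2 * of_real pi * \<i> * winding_number (\<lambda>t. c (T * t)) w) {s..s + T}"
proof -
  let ?g = "\<lambda>t. c (T * t)"
  let ?I = "2 * of_real pi * \<i> * winding_number ?g w"
  have T: "0 < T" and per: "\<And>t. c (t + T) = c t"
    using reg by (auto simp: simple_closed_param_def)
  have dg: "(?g has_vector_derivative T *\<^sub>R c' (T * t)) (at t)" for t
    using has_vector_derivative_affine[of c "c' (T * t)" 0 T t] c'(1) by simp
  have "?g C1_differentiable_on {0..1}"
    unfolding C1_differentiable_on_def
    using dg by (intro exI[of _ "\<lambda>t. T *\<^sub>R c' (T * t)"]) (auto intro!: continuous_intros continuous_on_compose2[OF c'(2)])
  then have "valid_path ?g" by (simp add: valid_path_def C1_differentiable_imp_piecewise)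
  then have "((\<lambda>z. 1 / (z - w)) has_contour_integral ?I) ?g"
    using w simple_closed_param_path(3)[OF reg] has_contour_integral_winding_number[of ?g w] by simp
  then have "((\<lambda>t. 1 / (?g t - w) * (T *\<^sub>R c' (T * t))) has_integral ?I) {0..1}"
    unfolding has_contour_integral_def
    by (rule has_integral_eq[rotated]) (simp add: vector_derivative_at_within_ivl[OF dg])
  then have "((\<lambda>t. (1 / (?g (1 / T * t + 0) - w) * (T *\<^sub>R c' (T * (1 / T * t + 0))))) has_integral (?I /\<^sub>R (1 / T))) {0..T}"
    using has_integral_affinity'[of "\<lambda>t. 1 / (?g t - w) * (T *\<^sub>R c' (T * t))" ?I 0 1 "1 / T" 0] T by simp
  then have "((\<lambda>t. T *\<^sub>R (c' t / (c t - w))) has_integral (T *\<^sub>R ?I)) {0..T}"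
    using T by simp
  then have "((\<lambda>t. c' t / (c t - w)) has_integral ?I) {0..T}"
    using T by (subst (asm) has_integral_cmul_iff) auto
  moreover have "c' (t + T) = c' t" for t
  proof -
    have "((\<lambda>t. c (t + T)) has_vector_derivative c' (t + T)) (at t)"
      using has_vector_derivative_affine[of c "c' (t + T)" T 1 t] c'(1) by (simp add: add.commute)
    then show ?thesis using c'(1)[of t] vector_derivative_unique_at by (simp add: per) blast
  qed
  ultimately show ?thesis using T by (intro has_integral_periodic) (auto simp: per)
qed

lemma winding_number_region:
  assumes \<Omega>: "C2_region \<Omega>" and reg: "simple_closed_param (frontier \<Omega>) T c"
    and ccw: "counterclockwise (frontier \<Omega>) T c" and w: "w \<notin> frontier \<Omega>"
  shows "winding_number (\<lambda>t. c (T * t)) w = (if w \<in> \<Omega> then 1 else 0)"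
proof -
  note g = simple_closed_param_path[OF reg]
  have iff: "w \<in> \<Omega> \<longleftrightarrow> w \<in> inside (frontier \<Omega>)"
    using \<Omega> by (intro C2_region_inside[OF _ _ g w]) (auto simp: C2_region_def)
  show ?thesis
  proof (cases "w \<in> \<Omega>")
    case True
    then show ?thesis using iff ccw by (auto simp: counterclockwise_def)
  next
    case False
    moreover have "w \<in> inside (frontier \<Omega>) \<union> outside (frontier \<Omega>)"
      unfolding inside_Un_outside using w by simp
    ultimately have "w \<in> outside (path_image (\<lambda>t. c (T * t)))"
      using iff g(3) by (metis UnE)
    then show ?thesis using False g by (simp add: winding_number_zero_in_outside simple_path_imp_path)
  qed
qed

text \<open>A simple closed path winds about its inside either once or minus once; in the second
  case the time-reversed curve is taken.\<close>

lemma counterclockwise_param_exists: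
  assumes "C2_region \<Omega>"
  obtains T c where "C2_regular_param (frontier \<Omega>) T c" "counterclockwise (frontier \<Omega>) T c"
proof -
  let ?C = "frontier \<Omega>"
  obtain T c where c: "C2_regular_param ?C T c"
    using assms by (auto simp: C2_region_def C2_simple_closed_curve_def)
  then have reg: "simple_closed_param ?C T c" by (simp add: C2_regular_param_def)
  note g = simple_closed_param_path[OF reg]
  from g(1) show ?thesis
  proof (cases rule: simple_closed_path_winding_number_inside)
    case 1
    then have "counterclockwise ?C T c" by (simp add: counterclockwise_def g(3))
    then show ?thesis using c that by blast
  next
    case 2
    have T: "0 < T" and per: "\<And>t. c (t + T) = c t" using reg by (auto simp: simple_closed_param_def)
    obtain c' c'' where c': "\<And>t. (c has_vector_derivative c' t) (at t)" "\<And>t. (c' has_vector_derivative c'' t) (at t)"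
      "\<And>t. c' t \<noteq> 0" "continuous_on UNIV c'"
      using c by (rule C2_regular_paramE) blast
    define r where "r t = c (- t)" for t
    have dr: "(r has_vector_derivative - c' (- t)) (at t)" for t
      using has_vector_derivative_affine[of c "c' (- t)" 0 "-1" t] c'(1) by (simp add: r_def[abs_def])
    have vr: "vector_derivative r (at t) = - c' (- t)" for t using dr vector_derivative_at by blast
    have ddr: "((\<lambda>t. - c' (- t)) has_vector_derivative c'' (- t)) (at t)" for t
      using has_vector_derivative_minus[OF has_vector_derivative_affine[of c' "c'' (- t)" 0 "-1" t]] c'(2) by simp
    have cc': "continuous_on UNIV c''"
    proof -
      have "vector_derivative c (at t) = c' t" "vector_derivative c' (at t) = c'' t" for t
        using c'(1,2) vector_derivative_at by blast+
      then show ?thesis using c by (auto simp: C2_regular_param_def C1_differentiable_on_eq)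
    qed
    have "simple_closed_param ?C T r"
      unfolding simple_closed_param_def
    proof (intro conjI allI)
      show "continuous_on UNIV r"
        using dr by (meson continuous_on_eq_continuous_within has_vector_derivative_continuous has_vector_derivative_at_within)
      show "r (t + T) = r t" for t using per[of "- t - T"] by (simp add: r_def)
      show "inj_on r {0..<T}"
        using simple_closed_param_inj[OF reg] by (fastforce simp: inj_on_def r_def)
      show "r ` {0..<T} = ?C"
      proof
        show "r ` {0..<T} \<subseteq> ?C" using simple_closed_param_image_period(2)[OF reg] by (auto simp: r_def)
        show "?C \<subseteq> r ` {0..<T}"
        proof
          fix z assume "z \<in> ?C"
          then obtain t where t: "t \<in> {0..<T}" "z = c t" using reg unfolding simple_closed_param_def by blast
          show "z \<in> r ` {0..<T}"
          \<comment> \<open>The reversed time \<open>T - t\<close> leaves the half-open interval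
            exactly when \<open>t = 0\<close>, but time 0 is fixed by the reversal.\<close>
          proof (cases "t = 0")
            case True
            then show ?thesis using t T by (force simp: r_def)
          next
            case False
            have "z = r (T - t)" using per[of "t - T"] t by (simp add: r_def)
            then show ?thesis using t False by auto
          qed
        qed
      qed
    qed (rule T)
    moreover have "r C1_differentiable_on UNIV"
      unfolding C1_differentiable_on_def
      using dr by (intro exI[of _ "\<lambda>t. - c' (- t)"]) (auto intro!: continuous_intros continuous_on_compose2[OF c'(4)])
    moreover have "(\<lambda>t. vector_derivative r (at t)) C1_differentiable_on UNIV"
      unfolding vr C1_differentiable_on_def
      using ddr by (intro exI[of _ "\<lambda>t. c'' (- t)"]) (auto intro!: continuous_intros continuous_on_compose2[OF cc'])
    ultimately have "C2_regular_param ?C T r" using c'(3) by (simp add: C2_regular_param_def vr)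
    moreover have "counterclockwise ?C T r"
      unfolding counterclockwise_def
    proof
      fix z assume z: "z \<in> inside ?C"
      have "(\<lambda>t. r (T * t)) = reversepath (\<lambda>t. c (T * t))"
      proof
        fix t show "r (T * t) = reversepath (\<lambda>t. c (T * t)) t"
          using per[of "- (T * t)"] by (simp add: r_def reversepath_def algebra_simps)
      qed
      moreover have "z \<notin> path_image (\<lambda>t. c (T * t))" using z inside_no_overlap[of ?C] g(3) by (metis IntI empty_iff)
      ultimately show "winding_number (\<lambda>t. r (T * t)) z = 1"
        using 2[of z] z g by (simp add: winding_number_reversepath simple_path_imp_path)
    qed
    ultimately show ?thesis by (rule that)
  qed
qed

section \<open>Reduction to normal position\<close>

text \<open>The inclusion \<open>sub\<close> is continuity alone; applied to the inverse map, with
  \<open>cnj u\<close> as inverse of \<open>u\<close>, it gives the reverse inclusion for interiors.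
  The frontier is then expressed by interiors of the set and of its complement.\<close>

lemma frontier_affine_vimage:
  fixes p u :: complex
  assumes u: "norm u = 1"
  shows "frontier {z. p + u * z \<in> S} = {z. p + u * z \<in> frontier S}"
proof -
  have uu: "u * (cnj u * x) = x" "cnj u * (u * x) = x" for x
    using u complex_norm_square[of u] by (simp_all add: mult.commute flip: mult.assoc)
  have sub: "{z. p + u * z \<in> interior S} \<subseteq> interior {z. p + u * z \<in> S}" for p u :: complex and S
  proof (rule interior_maximal)
    have "continuous_on UNIV (\<lambda>z. p + u * z)" by (intro continuous_intros)
    then show "open {z. p + u * z \<in> interior S}"
      using open_vimage[of "interior S" "\<lambda>z. p + u * z"] by (simp add: vimage_def)
  qed (use interior_subset in blast)
  have int: "interior {z. p + u * z \<in> S} = {z. p + u * z \<in> interior S}" for S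
  proof
    show "interior {z. p + u * z \<in> S} \<subseteq> {z. p + u * z \<in> interior S}"
    proof
      fix z assume "z \<in> interior {z. p + u * z \<in> S}"
      then have "p + u * z \<in> {y. - (cnj u * p) + cnj u * y \<in> interior {z. p + u * z \<in> S}}"
        by (simp add: distrib_left uu)
      then have "p + u * z \<in> interior {y. - (cnj u * p) + cnj u * y \<in> {z. p + u * z \<in> S}}"
        using sub by blast
      moreover have "{y. - (cnj u * p) + cnj u * y \<in> {z. p + u * z \<in> S}} = S"
      proof (intro set_eqI)
        fix y
        have "p + u * (- (cnj u * p) + cnj u * y) = y" by (simp add: right_diff_distrib uu)
        then show "y \<in> {y. - (cnj u * p) + cnj u * y \<in> {z. p + u * z \<in> S}} \<longleftrightarrow> y \<in> S"
          by (simp only: mem_Collect_eq)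
      qed
      ultimately show "z \<in> {z. p + u * z \<in> interior S}" by simp
    qed
  qed (rule sub)
  have "frontier {z. p + u * z \<in> S} = - interior {z. p + u * z \<in> - S} - interior {z. p + u * z \<in> S}"
    unfolding frontier_def closure_interior by (simp add: Collect_neg_eq)
  also have "\<dots> = {z. p + u * z \<in> frontier S}"
    unfolding int frontier_def closure_interior by auto
  finally show ?thesis .
qed

text \<open>Translate the point to 0, rotate its unit tangent \<open>u\<close> to 1, and divide time
  by the speed \<open>a\<close>. The rotation supplies one factor \<open>1 / a\<close> and two time
  derivatives supply two more, which is the cube in \<open>signed_curvature\<close>.\<close>

lemma normalized_boundary_exists:
  assumes \<Omega>: "C2_region \<Omega>" and c: "C2_regular_param (frontier \<Omega>) T c" "counterclockwise (frontier \<Omega>) T c"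
  obtains u D D' b h \<delta> \<eta> where "norm u = 1"
    "normalized_boundary D D' b h \<delta> \<eta> {z. c t + u * z \<in> \<Omega>}" "Im b = signed_curvature c t"
proof -
  have reg: "simple_closed_param (frontier \<Omega>) T c" using c(1) by (simp add: C2_regular_param_def)
  obtain c' c'' where c': "\<And>t. (c has_vector_derivative c' t) (at t)" "\<And>t. (c' has_vector_derivative c'' t) (at t)"
    "\<And>t. c' t \<noteq> 0" "continuous_on UNIV c'"
    and \<kappa>: "signed_curvature c t = Im (cnj (c' t) * c'' t) / norm (c' t) ^ 3"
    using c(1) by (rule C2_regular_paramE) blast
  have T: "0 < T" using reg by (simp add: simple_closed_param_def)
  define a where "a = norm (c' t)"
  define u where "u = c' t / of_real a"
  have a: "0 < a" using c'(3) by (simp add: a_def)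
  have u: "norm u = 1" using a by (simp add: u_def norm_divide) (simp add: a_def)
  have uu: "u * cnj u = 1" using u complex_norm_square[of u] by simp
  have u0: "u \<noteq> 0" using u by auto
  have cnj_u: "cnj u = inverse u" using uu u0 by (simp add: field_simps)
  define D where "D s = cnj u * (c (t + 1 / a * s) - c t)" for s
  define D' where "D' s = cnj u * ((1 / a) *\<^sub>R c' (t + 1 / a * s))" for s
  define b where "b = cnj u * ((1 / a) *\<^sub>R ((1 / a) *\<^sub>R c'' t))"
  \<comment> \<open>Half of the rescaled period \<open>a * T\<close>, so that the time window is
    symmetric about 0.\<close>
  define h where "h = a * T / 2"
  define E where "E = {z. c t + u * z \<in> \<Omega>}"
  have h: "0 < h" using a T by (simp add: h_def)
  have dD: "(D has_vector_derivative D' s) (at s)" for s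
  proof -
    have "((\<lambda>s. c (t + 1 / a * s) - c t) has_vector_derivative (1 / a) *\<^sub>R c' (t + 1 / a * s) - 0) (at s)"
      by (intro has_vector_derivative_diff has_vector_derivative_affine c' has_vector_derivative_const)
    from has_vector_derivative_mult_right[OF this, of "cnj u"] show ?thesis
      by (simp add: D_def[abs_def] D'_def)
  qed
  have dD': "(D' has_vector_derivative b) (at 0)"
  proof -
    have "((\<lambda>s. c' (t + 1 / a * s)) has_vector_derivative (1 / a) *\<^sub>R c'' t) (at 0)"
      using has_vector_derivative_affine[of c' "c'' t" t "1 / a" 0] c'(2)[of t] by simp
    then have "((\<lambda>s. (1 / a) *\<^sub>R c' (t + 1 / a * s)) has_vector_derivative (1 / a) *\<^sub>R ((1 / a) *\<^sub>R c'' t)) (at 0)"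
      by (rule bounded_linear.has_vector_derivative[OF bounded_linear_scaleR_right])
    from has_vector_derivative_mult_right[OF this, of "cnj u"] show ?thesis
      by (simp add: D'_def[abs_def] b_def)
  qed
  have contD': "continuous_on UNIV D'"
    unfolding D'_def by (intro continuous_intros continuous_on_compose2[OF c'(4)]) auto
  have D0: "D 0 = 0" "D' 0 = 1"
  proof -
    have "c' t = u * of_real a" using a by (simp add: u_def)
    then show "D' 0 = 1" using a uu by (simp add: D'_def scaleR_conv_of_real mult.commute)
  qed (simp add: D_def)
  have D_iff: "D s = w \<longleftrightarrow> c (t + 1 / a * s) = c t + u * w" for s w
    using u0 by (auto simp: D_def cnj_u field_simps)
  have image: "D ` {-h..h} = {z. c t + u * z \<in> frontier \<Omega>}"
  proof -
    have "(\<lambda>s. t + 1 / a * s) ` {-h..h} = {t - T / 2..t - T / 2 + T}"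
    proof (intro equalityI subsetI)
      fix x assume x: "x \<in> {t - T / 2..t - T / 2 + T}"
      have "a * (- (T / 2)) \<le> a * (x - t)" "a * (x - t) \<le> a * (T / 2)"
        using x a by (intro mult_left_mono; simp)+
      then show "x \<in> (\<lambda>s. t + 1 / a * s) ` {-h..h}"
        using a by (intro image_eqI[of _ _ "a * (x - t)"]) (simp_all add: h_def)
    qed (use a in \<open>auto simp: h_def field_simps\<close>)
    then have im: "c ` ((\<lambda>s. t + 1 / a * s) ` {-h..h}) = frontier \<Omega>"
      using simple_closed_param_image_period(1)[OF reg, of "t - T / 2"] by (simp only:)
    show ?thesis
    proof (intro equalityI subsetI)
      fix z assume "z \<in> {z. c t + u * z \<in> frontier \<Omega>}"
      then obtain s where "s \<in> {-h..h}" "c (t + 1 / a * s) = c t + u * z" unfolding im[symmetric] by auto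
      moreover from this have "z = D s" using D_iff[of s z] by metis
      ultimately show "z \<in> D ` {-h..h}" by (intro image_eqI)
    next
      fix z assume "z \<in> D ` {-h..h}"
      then obtain s where "s \<in> {-h..h}" "D s = z" by blast
      then have "c t + u * z = c (t + 1 / a * s)" "s \<in> {-h..h}" using D_iff[of s z] by auto
      then show "z \<in> {z. c t + u * z \<in> frontier \<Omega>}" unfolding im[symmetric] by blast
    qed
  qed
  have wind: "((\<lambda>s. D' s / (D s - w)) has_integral (if w \<in> E then 2 * of_real pi * \<i> else 0)) {-h..h}"
    if w: "w \<notin> D ` {-h..h}" for w
  proof -
    let ?z = "c t + u * w"
    let ?I = "if w \<in> E then 2 * of_real pi * \<i> else (0::complex)"
    have z: "?z \<notin> frontier \<Omega>" using w by (simp add: image)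
    have "((\<lambda>x. c' x / (c x - ?z)) has_integral ?I) {t - T / 2..t - T / 2 + T}"
      using winding_integral[OF reg c'(1,4) z, of "t - T / 2"] winding_number_region[OF \<Omega> reg c(2) z]
      by (simp add: E_def split: if_splits)
    then have "((\<lambda>s. c' (1 / a * s + t) / (c (1 / a * s + t) - ?z)) has_integral (?I /\<^sub>R (1 / a)))
        {(t - T / 2 - t) /\<^sub>R (1 / a)..(t - T / 2 + T - t) /\<^sub>R (1 / a)}"
      using has_integral_affinity'[of "\<lambda>x. c' x / (c x - ?z)" ?I "t - T / 2" "t - T / 2 + T" "1 / a" t] a by simp
    moreover have "(t - T / 2 - t) /\<^sub>R (1 / a) = - h" "(t - T / 2 + T - t) /\<^sub>R (1 / a) = h"
      using a by (simp_all add: h_def field_simps)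
    ultimately have "((\<lambda>s. c' (t + 1 / a * s) / (c (t + 1 / a * s) - ?z)) has_integral (a *\<^sub>R ?I)) {-h..h}"
      using a by (simp add: add.commute)
    then have "((\<lambda>s. (1 / a) *\<^sub>R (c' (t + 1 / a * s) / (c (t + 1 / a * s) - ?z))) has_integral ((1 / a) *\<^sub>R (a *\<^sub>R ?I))) {-h..h}"
      by (rule has_integral_cmul)
    moreover have "(1 / a) *\<^sub>R (c' (t + 1 / a * s) / (c (t + 1 / a * s) - ?z)) = D' s / (D s - w)" for s
    proof -
      have "D s - w = cnj u * (c (t + 1 / a * s) - ?z)"
        using u0 by (simp add: D_def cnj_u field_simps)
      then show ?thesis using u0 by (simp add: D'_def cnj_u scaleR_conv_of_real)
    qed
    ultimately show ?thesis using a by simp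
  qed
  have nonzero: "D s \<noteq> 0" if "0 < \<bar>s\<bar>" "\<bar>s\<bar> \<le> h" for s
  proof
    assume "D s = 0"
    then have "c (t + 1 / a * s) = c t" using D_iff[of s 0] by simp
    moreover have "\<bar>(t + 1 / a * s) - t\<bar> < T"
    proof -
      have "\<bar>s\<bar> < a * T" using that(2) mult_pos_pos[OF a T] by (simp add: h_def)
      then show ?thesis using a by (simp add: abs_mult field_simps)
    qed
    ultimately have "t + 1 / a * s = t" by (rule simple_closed_param_inj[OF reg])
    then show False using that a by simp
  qed
  obtain \<delta> where \<delta>: "0 < \<delta>" "\<delta> \<le> h" "\<And>s. \<bar>s\<bar> \<le> \<delta> \<Longrightarrow> cmod (D' s - 1) \<le> 1 / 10"
  proof -
    have "isCont D' 0" using contD' by (simp add: continuous_on_eq_continuous_at)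
    then have "\<exists>d>0. \<forall>x. dist x 0 < d \<longrightarrow> dist (D' x) (D' 0) < 1 / 10"
      unfolding continuous_at_eps_delta by (rule spec[where x = "1 / 10", THEN mp]) simp
    then obtain d where d: "0 < d" "\<And>x. \<bar>x\<bar> < d \<Longrightarrow> dist (D' x) (D' 0) < 1 / 10" by auto
    show ?thesis
    proof (rule that[of "min (d / 2) h"])
      fix s assume "\<bar>s\<bar> \<le> min (d / 2) h"
      then have "\<bar>s\<bar> < d" using d by auto
      then show "cmod (D' s - 1) \<le> 1 / 10" using d(2)[of s] by (simp add: D0 dist_norm)
    qed (use d h in auto)
  qed
  \<comment> \<open>A compact set of times on which \<open>D\<close> has no zero, since they are at
    most half a period away from 0; the minimum of the modulus there is the \<eta> of the
    locale.\<close>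
  define K where "K = {-h..-\<delta>} \<union> {\<delta>..h}"
  have contD: "continuous_on S D" for S
    by (meson continuous_on_eq_continuous_within dD has_vector_derivative_continuous has_vector_derivative_at_within)
  obtain x where x: "x \<in> K" "\<And>y. y \<in> K \<Longrightarrow> cmod (D x) \<le> cmod (D y)"
  proof -
    have "compact K" unfolding K_def by (intro compact_Un compact_Icc)
    moreover have "\<delta> \<in> K" using \<delta> by (simp add: K_def)
    moreover have "continuous_on K (\<lambda>x. cmod (D x))" by (intro continuous_intros contD)
    ultimately show ?thesis using continuous_attains_inf[of K "\<lambda>x. cmod (D x)"] that by blast
  qed
  define \<eta> where "\<eta> = cmod (D x)"
  have "normalized_boundary D D' b h \<delta> \<eta> E"
  proof
    show "0 < \<eta>" using x(1) nonzero[of x] \<delta> by (auto simp: \<eta>_def K_def)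
    show "\<eta> \<le> cmod (D s)" if "\<delta> \<le> \<bar>s\<bar>" "\<bar>s\<bar> \<le> h" for s
    proof -
      have "s \<in> K" using that by (cases "0 \<le> s") (auto simp: K_def)
      then show ?thesis by (simp add: \<eta>_def x(2))
    qed
    have "closed \<Omega>" using \<Omega> by (simp add: C2_region_def compact_imp_closed)
    moreover have "continuous_on UNIV (\<lambda>z. c t + u * z)" by (intro continuous_intros)
    ultimately show "closed E"
      unfolding E_def using closed_vimage[of \<Omega> "\<lambda>z. c t + u * z"] by (simp add: vimage_def)
    show "frontier E = D ` {-h..h}" unfolding E_def image by (rule frontier_affine_vimage[OF u])
  qed (use dD dD' contD' D0 \<delta> wind in auto)
  moreover have "Im b = signed_curvature c t"
  proof -
    have "b = of_real (1 / a ^ 3) * (cnj (c' t) * c'' t)"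
      using a by (simp add: b_def u_def scaleR_conv_of_real power3_eq_cube)
    then show ?thesis by (simp add: \<kappa> a_def)
  qed
  ultimately show ?thesis using that u unfolding E_def by blast
qed

section \<open>Curvature recovered from the areas\<close>

lemma disk_density_limit:
  assumes \<Omega>: "C2_region \<Omega>" and c: "C2_regular_param (frontier \<Omega>) T c" "counterclockwise (frontier \<Omega>) T c"
  shows "right_slope_limit (\<lambda>\<rho>. measure lebesgue (\<Omega> \<inter> cball (c t) \<rho>) / (pi * \<rho>\<^sup>2))
    (- signed_curvature c t / (3 * pi))"
proof -
  obtain u D D' b h \<delta> \<eta> where u: "norm u = 1" and b: "Im b = signed_curvature c t"
    and nb: "normalized_boundary D D' b h \<delta> \<eta> {z. c t + u * z \<in> \<Omega>}"
    by (rule normalized_boundary_exists[OF assms])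
  have closed: "closed \<Omega>" using \<Omega> by (simp add: C2_region_def compact_imp_closed)
  have "measure lborel ({z. c t + u * z \<in> \<Omega>} \<inter> cball 0 r) = measure lebesgue (\<Omega> \<inter> cball (c t) r)" for r
  proof -
    have B: "\<Omega> \<inter> cball (c t) r \<in> sets borel" using closed by simp
    have "{z. c t + u * z \<in> \<Omega>} \<inter> cball 0 r = {z. c t + u * z \<in> \<Omega> \<inter> cball (c t) r}"
      using u by (auto simp: dist_norm norm_mult)
    then show ?thesis using emeasure_affine_vimage[OF u B, of "c t"] B by (simp add: measure_def)
  qed
  then show ?thesis using normalized_boundary.density_limit[OF nb] by (simp add: b)
qed

text \<open>The slope limit depends on the point alone, which makes the definite description in
  \<^const>\<open>curvature_at\<close> well defined.\<close>

lemma curvature_at_eq: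
  assumes \<Omega>: "C2_region \<Omega>" and c: "C2_regular_param (frontier \<Omega>) T c" "counterclockwise (frontier \<Omega>) T c"
  shows "curvature_at (frontier \<Omega>) (c t) = signed_curvature c t"
  unfolding curvature_at_def
proof (rule the_equality)
  show "\<exists>T c' t'. C2_regular_param (frontier \<Omega>) T c' \<and> counterclockwise (frontier \<Omega>) T c' \<and>
      c' t' = c t \<and> signed_curvature c t = signed_curvature c' t'"
    using c by blast
  fix k assume "\<exists>T c' t'. C2_regular_param (frontier \<Omega>) T c' \<and> counterclockwise (frontier \<Omega>) T c' \<and>
      c' t' = c t \<and> k = signed_curvature c' t'"
  then obtain T' c' t' where c': "C2_regular_param (frontier \<Omega>) T' c'" "counterclockwise (frontier \<Omega>) T' c'"
    and eq: "c' t' = c t" "k = signed_curvature c' t'" by blast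
  have "- signed_curvature c t / (3 * pi) = - signed_curvature c' t' / (3 * pi)"
    \<comment> \<open>Both parameterizations pass through the same point, so the two density
      functions coincide at all radii and the interval of agreement can be
      \<open>{0<..<1}\<close>.\<close>
    by (rule right_slope_limit_unique[OF disk_density_limit[OF \<Omega> c, of t] disk_density_limit[OF \<Omega> c', of t'] zero_less_one])
       (simp only: eq(1))
  then show "k = signed_curvature c t" by (simp add: eq)
qed

text \<open>The area depends on \<gamma> only through the point \<open>\<gamma> s\<close>, so a
  counterclockwise C2 parameterization through that point can stand in for it.\<close>

lemma disk_density_limit_curvature:
  assumes \<Omega>: "C2_region \<Omega>" and p: "\<gamma> s \<in> frontier \<Omega>"
  shows "right_slope_limit (\<lambda>\<rho>. disk_area \<Omega> \<gamma> s \<rho> / (pi * \<rho>\<^sup>2)) (- curvature_at (frontier \<Omega>) (\<gamma> s) / (3 * pi))"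
proof -
  obtain T c where c: "C2_regular_param (frontier \<Omega>) T c" "counterclockwise (frontier \<Omega>) T c"
    by (rule counterclockwise_param_exists[OF \<Omega>])
  then obtain t where t: "\<gamma> s = c t"
    using p simple_closed_param_image_period(2)[of "frontier \<Omega>" T c] by (auto simp: C2_regular_param_def)
  show ?thesis
    unfolding disk_area_def t curvature_at_eq[OF \<Omega> c] by (rule disk_density_limit[OF \<Omega> c])
qed

text \<open>Determination is expressed as injectivity: equal area data force equal curvature. Since
  the slope limit is \<open>- \<kappa> / (3 * pi)\<close>, agreement on a small range of radii
  suffices, and solving for \<kappa> gives the factor \<open>- 3 * pi\<close>.\<close>

theorem theorem4p11p1:
  fixes \<Omega> :: "complex set" and L :: real
  assumes "C2_region \<Omega>"
  shows
    "(\<forall>(\<epsilon>::real) \<gamma> \<Omega>' \<gamma>'.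
        0 < \<epsilon> \<and> arclength_param (frontier \<Omega>) L \<gamma> \<and>
        C2_region \<Omega>' \<and> arclength_param (frontier \<Omega>') L \<gamma>' \<and>
        (\<forall>s\<in>{0..<L}. \<forall>r\<in>{0<..<\<epsilon>}. disk_area \<Omega> \<gamma> s r = disk_area \<Omega>' \<gamma>' s r) \<longrightarrow>
        (\<forall>s\<in>{0..<L}. curvature_at (frontier \<Omega>) (\<gamma> s) = curvature_at (frontier \<Omega>') (\<gamma>' s)))
     \<and>
     (\<forall>\<gamma>. arclength_param (frontier \<Omega>) L \<gamma> \<and> counterclockwise (frontier \<Omega>) L \<gamma> \<longrightarrow>
        (\<forall>s\<in>{0..<L}.
           (\<forall>\<^sub>F r in at_right 0.
              (\<lambda>\<rho>. disk_area \<Omega> \<gamma> s \<rho> / (pi * \<rho>\<^sup>2)) field_differentiable (at r)) \<and>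
           (\<exists>l. ((\<lambda>r. deriv (\<lambda>\<rho>. disk_area \<Omega> \<gamma> s \<rho> / (pi * \<rho>\<^sup>2)) r) \<longlongrightarrow> l) (at_right 0) \<and>
                curvature_at (frontier \<Omega>) (\<gamma> s) = - 3 * pi * l)))"
proof (intro conjI allI impI ballI)
  have limit: "right_slope_limit (\<lambda>\<rho>. disk_area A \<gamma> s \<rho> / (pi * \<rho>\<^sup>2)) (- curvature_at (frontier A) (\<gamma> s) / (3 * pi))"
    if "C2_region A" "arclength_param (frontier A) L \<gamma>" "s \<in> {0..<L}" for A \<gamma> s
  proof (rule disk_density_limit_curvature[OF that(1)])
    show "\<gamma> s \<in> frontier A" using that(2,3) unfolding arclength_param_def simple_closed_param_def by blast
  qed
  {
    fix \<epsilon> :: real and \<gamma> \<Omega>' \<gamma>' s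
    assume H: "0 < \<epsilon> \<and> arclength_param (frontier \<Omega>) L \<gamma> \<and>
        C2_region \<Omega>' \<and> arclength_param (frontier \<Omega>') L \<gamma>' \<and>
        (\<forall>s\<in>{0..<L}. \<forall>r\<in>{0<..<\<epsilon>}. disk_area \<Omega> \<gamma> s r = disk_area \<Omega>' \<gamma>' s r)" and s: "s \<in> {0..<L}"
    have "- curvature_at (frontier \<Omega>) (\<gamma> s) / (3 * pi) = - curvature_at (frontier \<Omega>') (\<gamma>' s) / (3 * pi)"
    proof (rule right_slope_limit_unique)
      show "right_slope_limit (\<lambda>\<rho>. disk_area \<Omega> \<gamma> s \<rho> / (pi * \<rho>\<^sup>2)) (- curvature_at (frontier \<Omega>) (\<gamma> s) / (3 * pi))"
        using assms H s by (intro limit) auto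
      show "right_slope_limit (\<lambda>\<rho>. disk_area \<Omega>' \<gamma>' s \<rho> / (pi * \<rho>\<^sup>2)) (- curvature_at (frontier \<Omega>') (\<gamma>' s) / (3 * pi))"
        using H s by (intro limit) auto
      show "disk_area \<Omega> \<gamma> s r / (pi * r\<^sup>2) = disk_area \<Omega>' \<gamma>' s r / (pi * r\<^sup>2)" if "r \<in> {0<..<\<epsilon>}" for r
        using H s that by simp
    qed (use H in simp)
    then show "curvature_at (frontier \<Omega>) (\<gamma> s) = curvature_at (frontier \<Omega>') (\<gamma>' s)" by simp
  }
  fix \<gamma> s assume \<gamma>: "arclength_param (frontier \<Omega>) L \<gamma> \<and> counterclockwise (frontier \<Omega>) L \<gamma>" and s: "s \<in> {0..<L}"
  let ?F = "\<lambda>\<rho>. disk_area \<Omega> \<gamma> s \<rho> / (pi * \<rho>\<^sup>2)"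
  have lim: "right_slope_limit ?F (- curvature_at (frontier \<Omega>) (\<gamma> s) / (3 * pi))"
    using limit[OF assms] \<gamma> s by blast
  then show "\<forall>\<^sub>F r in at_right 0. ?F field_differentiable (at r)" by (simp add: right_slope_limit_def)
  show "\<exists>l. (deriv ?F \<longlongrightarrow> l) (at_right 0) \<and> curvature_at (frontier \<Omega>) (\<gamma> s) = - 3 * pi * l"
    using lim unfolding right_slope_limit_def
    by (intro exI[of _ "- curvature_at (frontier \<Omega>) (\<gamma> s) / (3 * pi)"]) simp
qed

end
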